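(* Let $H$ be a right Hopf coquasigroup in $\mathsf{C}$ with right antipode $\rho_H$. Let $J:K\to H\otimes H$ be a conormal twist, and let $H_J=(H,\eta_H,\mu_H,\varepsilon_H,\delta_{H_J})$ be the twist deformation of $H$ by $J$, which is a non-coassociative bimonoid. Then $H_J$ is a right Hopf coquasigroup with right antipode $$\rho_{H_J}=\mu_H\circ((\mu_H\circ(v_R^{-1}\otimes\rho_H))\otimes v_R),$$ where $v_R=\mu_H\circ(\rho_H\otimes H)\circ J:K\to H$ and $v_R^{-1}=\mu_H\circ(H\otimes\rho_H)\circ J^{-1}:K\to H$.
   Context: $\mathsf{C}$ is a strict symmetric monoidal category with tensor product $\otimes$, unit object $K$ and symmetry $c$. For an object $P$ and a morphism $f$, write $P\otimes f$ for $\mathrm{id}_P\otimes f$ and $f\otimes P$ for $f\otimes \mathrm{id}_P$. For monoids $A,B$, the object $A\otimes B$ is a monoid with unit $\eta_A\otimes\eta_B$ and product $\mu_{A\otimes B}=(\mu_A\otimes\mu_B)\circ(A\otimes c_{B,A}\otimes B)$. A counital comagma is a triple $(D,\varepsilon_D,\delta_D)$ with $\varepsilon_D:D\to K$, $\delta_D:D\to D\otimes D$ such that $(\varepsilon_D\otimes D)\circ\delta_D=\mathrm{id}_D=(D\otimes\varepsilon_D)\circ\delta_D$ (no coassociativity required). A non-coassociative bimonoid is an object $H$ with a monoid structure $(H,\eta_H,\mu_H)$ (unital and associative) and a counital comagma structure $(H,\varepsilon_H,\delta_H)$ such that $\varepsilon_H\circ\eta_H=\mathrm{id}_K$, $\delta_H\circ\eta_H=\eta_H\otimes\eta_H$,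 $\varepsilon_H\circ\mu_H=\varepsilon_H\otimes\varepsilon_H$, and $\delta_H\circ\mu_H=\mu_{H\otimes H}\circ(\delta_H\otimes\delta_H)$. A right Hopf coquasigroup is a non-coassociative bimonoid $H$ for which there exists a morphism $\rho_H:H\to H$ (the right antipode) such that $$(H\otimes\mu_H)\circ(\delta_H\otimes\rho_H)\circ\delta_H=H\otimes\eta_H=(H\otimes\mu_H)\circ(((H\otimes\rho_H)\circ\delta_H)\otimes H)\circ\delta_H.$$ For a monoid $A$ and $f,g:K\to A$, the convolution product is $f\ast g=\mu_A\circ(f\otimes g)$; $f$ is convolution invertible if there is $f^{-1}:K\to A$ with $f\ast f^{-1}=f^{-1}\ast f=\eta_A$. A twist for $H$ is a convolution invertible morphism $J:K\to H\otimes H$ (convolution taken in the monoid $H\otimes H$), with inverse $J^{-1}$, such that, in the monoid $H\otimes H\otimes H$, $$((\delta_H\otimes H)\circ J)\ast(J\otimes\eta_H)=((H\otimes\delta_H)\circ J)\ast(\eta_H\otimes J).$$ $J$ is conormal if $(\varepsilon_H\otimes H)\circ J=\eta_H=(H\otimes\varepsilon_H)\circ J$. The coproduct of the twist deformation $H_J$ is $$\delta_{H_J}=\mu_{H\otimes H}\circ(\mu_{H\otimes H}\otimes H\otimes H)\circ(J^{-1}\otimes\delta_H\otimes J).$$ *)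

theory Defs
  imports Main
begin

section \<open>Strict symmetric monoidal categories\<close>

text \<open>Composition and tensor product of morphisms are total functions on the type of morphisms;
  they are only constrained on morphisms of the category, and composition only on composable
  pairs.\<close>

record ('o, 'm) smcat =
  ob :: "'o set"
  mor :: "'m set"
  dom :: "'m \<Rightarrow> 'o"
  cod :: "'m \<Rightarrow> 'o"
  idm :: "'o \<Rightarrow> 'm" ("\<one>\<index> _" [81] 80)
  comp :: "'m \<Rightarrow> 'm \<Rightarrow> 'm" (infixl "\<cdot>\<index>" 65)
  tens_ob :: "'o \<Rightarrow> 'o \<Rightarrow> 'o" (infixl "\<odot>\<index>" 70)
  tens :: "'m \<Rightarrow> 'm \<Rightarrow> 'm" (infixl "\<otimes>\<index>" 70)
  unit_ob :: "'o" ("\<K>\<index>")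
  symm :: "'o \<Rightarrow> 'o \<Rightarrow> 'm"

definition hom :: "('o, 'm) smcat \<Rightarrow> 'o \<Rightarrow> 'o \<Rightarrow> 'm set" where
  "hom C X Y = {f \<in> mor C. dom C f = X \<and> cod C f = Y}"

locale strict_symmetric_monoidal_category =
  fixes C :: "('o, 'm) smcat" (structure)
  assumes dom_ob: "f \<in> mor C \<Longrightarrow> dom C f \<in> ob C"
    and cod_ob: "f \<in> mor C \<Longrightarrow> cod C f \<in> ob C"
    and id_hom: "X \<in> ob C \<Longrightarrow> \<one> X \<in> hom C X X"
    and comp_hom: "f \<in> hom C X Y \<Longrightarrow> g \<in> hom C Y Z \<Longrightarrow> g \<cdot> f \<in> hom C X Z"
    and comp_assoc: "f \<in> hom C X Y \<Longrightarrow> g \<in> hom C Y Z \<Longrightarrow> h \<in> hom C Z W \<Longrightarrow>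
          (h \<cdot> g) \<cdot> f = h \<cdot> (g \<cdot> f)"
    and id_comp: "f \<in> hom C X Y \<Longrightarrow> \<one> Y \<cdot> f = f"
    and comp_id: "f \<in> hom C X Y \<Longrightarrow> f \<cdot> \<one> X = f"
    and unit_ob: "\<K> \<in> ob C"
    and tens_ob: "X \<in> ob C \<Longrightarrow> Y \<in> ob C \<Longrightarrow> X \<odot> Y \<in> ob C"
    and tens_hom: "f \<in> hom C X Y \<Longrightarrow> g \<in> hom C X' Y' \<Longrightarrow> f \<otimes> g \<in> hom C (X \<odot> X') (Y \<odot> Y')"
    and tens_id: "X \<in> ob C \<Longrightarrow> Y \<in> ob C \<Longrightarrow> \<one> X \<otimes> \<one> Y = \<one> (X \<odot> Y)"
    and interchange: "f \<in> hom C X Y \<Longrightarrow> g \<in> hom C Y Z \<Longrightarrow> f' \<in> hom C X' Y' \<Longrightarrow> g' \<in> hom C Y' Z' \<Longrightarrow>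
          (g \<cdot> f) \<otimes> (g' \<cdot> f') = (g \<otimes> g') \<cdot> (f \<otimes> f')"
    and tens_ob_assoc: "X \<in> ob C \<Longrightarrow> Y \<in> ob C \<Longrightarrow> Z \<in> ob C \<Longrightarrow> (X \<odot> Y) \<odot> Z = X \<odot> (Y \<odot> Z)"
    and unit_tens_ob: "X \<in> ob C \<Longrightarrow> \<K> \<odot> X = X"
    and tens_unit_ob: "X \<in> ob C \<Longrightarrow> X \<odot> \<K> = X"
    and tens_assoc: "f \<in> mor C \<Longrightarrow> g \<in> mor C \<Longrightarrow> h \<in> mor C \<Longrightarrow> (f \<otimes> g) \<otimes> h = f \<otimes> (g \<otimes> h)"
    and unit_tens: "f \<in> mor C \<Longrightarrow> \<one> \<K> \<otimes> f = f"
    and tens_unit: "f \<in> mor C \<Longrightarrow> f \<otimes> \<one> \<K> = f"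
    and symm_hom: "X \<in> ob C \<Longrightarrow> Y \<in> ob C \<Longrightarrow> symm C X Y \<in> hom C (X \<odot> Y) (Y \<odot> X)"
    and symm_natural: "f \<in> hom C X X' \<Longrightarrow> g \<in> hom C Y Y' \<Longrightarrow>
          symm C X' Y' \<cdot> (f \<otimes> g) = (g \<otimes> f) \<cdot> symm C X Y"
    and symm_symm: "X \<in> ob C \<Longrightarrow> Y \<in> ob C \<Longrightarrow> symm C Y X \<cdot> symm C X Y = \<one> (X \<odot> Y)"
    and hexagon: "X \<in> ob C \<Longrightarrow> Y \<in> ob C \<Longrightarrow> Z \<in> ob C \<Longrightarrow>
          symm C X (Y \<odot> Z) = (\<one> Y \<otimes> symm C X Z) \<cdot> (symm C X Y \<otimes> \<one> Z)"
  \<comment> \<open>The other hexagon and \<open>symm C X \<K> = \<one> X = symm C \<K> X\<close> follow from these axioms.\<close>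


section \<open>Monoids, comagmas and bimonoids\<close>

record ('o, 'm) monoid_data =
  obj :: "'o"
  eta :: "'m" ("\<eta>")
  mult :: "'m" ("\<mu>")

record ('o, 'm) bimonoid_data = "('o, 'm) monoid_data" +
  counit :: "'m" ("\<epsilon>")
  comult :: "'m" ("\<delta>")

context
  fixes C :: "('o, 'm) smcat" (structure)
begin

definition is_monoid :: "('o, 'm, 'z) monoid_data_scheme \<Rightarrow> bool" where
  "is_monoid A \<longleftrightarrow>
     obj A \<in> ob C \<and> \<eta> A \<in> hom C \<K> (obj A) \<and> \<mu> A \<in> hom C (obj A \<odot> obj A) (obj A) \<and>
     \<mu> A \<cdot> (\<eta> A \<otimes> \<one> (obj A)) = \<one> (obj A) \<and>
     \<mu> A \<cdot> (\<one> (obj A) \<otimes> \<eta> A) = \<one> (obj A) \<and>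
     \<mu> A \<cdot> (\<mu> A \<otimes> \<one> (obj A)) = \<mu> A \<cdot> (\<one> (obj A) \<otimes> \<mu> A)"

definition tensor_monoid ::
  "('o, 'm, 'y) monoid_data_scheme \<Rightarrow> ('o, 'm, 'z) monoid_data_scheme \<Rightarrow> ('o, 'm) monoid_data" where
  "tensor_monoid A B =
     \<lparr> obj = obj A \<odot> obj B,
       eta = \<eta> A \<otimes> \<eta> B,
       mult = (\<mu> A \<otimes> \<mu> B) \<cdot> (\<one> (obj A) \<otimes> symm C (obj B) (obj A) \<otimes> \<one> (obj B)) \<rparr>"

definition convolution :: "('o, 'm, 'z) monoid_data_scheme \<Rightarrow> 'm \<Rightarrow> 'm \<Rightarrow> 'm" where
  "convolution A f g = \<mu> A \<cdot> (f \<otimes> g)"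

definition convolution_inverse :: "('o, 'm, 'z) monoid_data_scheme \<Rightarrow> 'm \<Rightarrow> 'm \<Rightarrow> bool" where
  "convolution_inverse A f g \<longleftrightarrow>
     f \<in> hom C \<K> (obj A) \<and> g \<in> hom C \<K> (obj A) \<and>
     convolution A f g = \<eta> A \<and> convolution A g f = \<eta> A"

definition convolution_invertible :: "('o, 'm, 'z) monoid_data_scheme \<Rightarrow> 'm \<Rightarrow> bool" where
  "convolution_invertible A f \<longleftrightarrow> (\<exists>g. convolution_inverse A f g)"

definition counital_comagma :: "('o, 'm, 'z) bimonoid_data_scheme \<Rightarrow> bool" where
  "counital_comagma D \<longleftrightarrow>
     obj D \<in> ob C \<and> \<epsilon> D \<in> hom C (obj D) \<K> \<and> \<delta> D \<in> hom C (obj D) (obj D \<odot> obj D) \<and>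
     (\<epsilon> D \<otimes> \<one> (obj D)) \<cdot> \<delta> D = \<one> (obj D) \<and>
     (\<one> (obj D) \<otimes> \<epsilon> D) \<cdot> \<delta> D = \<one> (obj D)"

definition noncoassociative_bimonoid :: "('o, 'm, 'z) bimonoid_data_scheme \<Rightarrow> bool" where
  "noncoassociative_bimonoid H \<longleftrightarrow>
     is_monoid H \<and> counital_comagma H \<and>
     \<epsilon> H \<cdot> \<eta> H = \<one> \<K> \<and>
     \<delta> H \<cdot> \<eta> H = \<eta> H \<otimes> \<eta> H \<and>
     \<epsilon> H \<cdot> \<mu> H = \<epsilon> H \<otimes> \<epsilon> H \<and>
     \<delta> H \<cdot> \<mu> H = \<mu> (tensor_monoid H H) \<cdot> (\<delta> H \<otimes> \<delta> H)"

definition right_antipode :: "('o, 'm, 'z) bimonoid_data_scheme \<Rightarrow> 'm \<Rightarrow> bool" where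
  "right_antipode H \<rho> \<longleftrightarrow>
     \<rho> \<in> hom C (obj H) (obj H) \<and>
     (\<one> (obj H) \<otimes> \<mu> H) \<cdot> (\<delta> H \<otimes> \<rho>) \<cdot> \<delta> H = \<one> (obj H) \<otimes> \<eta> H \<and>
     (\<one> (obj H) \<otimes> \<mu> H) \<cdot> (((\<one> (obj H) \<otimes> \<rho>) \<cdot> \<delta> H) \<otimes> \<one> (obj H)) \<cdot> \<delta> H = \<one> (obj H) \<otimes> \<eta> H"

definition right_Hopf_coquasigroup :: "('o, 'm, 'z) bimonoid_data_scheme \<Rightarrow> bool" where
  "right_Hopf_coquasigroup H \<longleftrightarrow> noncoassociative_bimonoid H \<and> (\<exists>\<rho>. right_antipode H \<rho>)"


section \<open>Twists and twist deformations\<close>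

text \<open>The product of three copies of a monoid is bracketed to the left; as the category is strict,
  the other bracketing gives the same monoid.\<close>

definition twist :: "('o, 'm, 'z) bimonoid_data_scheme \<Rightarrow> 'm \<Rightarrow> bool" where
  "twist H J \<longleftrightarrow>
     J \<in> hom C \<K> (obj H \<odot> obj H) \<and>
     convolution_invertible (tensor_monoid H H) J \<and>
     convolution (tensor_monoid (tensor_monoid H H) H)
       ((\<delta> H \<otimes> \<one> (obj H)) \<cdot> J) (J \<otimes> \<eta> H) =
     convolution (tensor_monoid (tensor_monoid H H) H)
       ((\<one> (obj H) \<otimes> \<delta> H) \<cdot> J) (\<eta> H \<otimes> J)"

definition conormal :: "('o, 'm, 'z) bimonoid_data_scheme \<Rightarrow> 'm \<Rightarrow> bool" where
  "conormal H J \<longleftrightarrow>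
     (\<epsilon> H \<otimes> \<one> (obj H)) \<cdot> J = \<eta> H \<and> (\<one> (obj H) \<otimes> \<epsilon> H) \<cdot> J = \<eta> H"

text \<open>In the following, \<open>J'\<close> stands for the convolution inverse of \<open>J\<close>.\<close>

definition twist_deformation ::
  "('o, 'm) bimonoid_data \<Rightarrow> 'm \<Rightarrow> 'm \<Rightarrow> ('o, 'm) bimonoid_data" where
  "twist_deformation H J J' =
     H\<lparr> comult := \<mu> (tensor_monoid H H)
          \<cdot> (\<mu> (tensor_monoid H H) \<otimes> \<one> (obj H) \<otimes> \<one> (obj H))
          \<cdot> (J' \<otimes> \<delta> H \<otimes> J) \<rparr>"

definition v_R :: "('o, 'm) bimonoid_data \<Rightarrow> 'm \<Rightarrow> 'm \<Rightarrow> 'm" where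
  "v_R H \<rho> J = \<mu> H \<cdot> (\<rho> \<otimes> \<one> (obj H)) \<cdot> J"

definition v_R_inv :: "('o, 'm) bimonoid_data \<Rightarrow> 'm \<Rightarrow> 'm \<Rightarrow> 'm" where
  "v_R_inv H \<rho> J' = \<mu> H \<cdot> (\<one> (obj H) \<otimes> \<rho>) \<cdot> J'"

definition twisted_antipode :: "('o, 'm) bimonoid_data \<Rightarrow> 'm \<Rightarrow> 'm \<Rightarrow> 'm \<Rightarrow> 'm" where
  "twisted_antipode H \<rho> J J' =
     \<mu> H \<cdot> ((\<mu> H \<cdot> (v_R_inv H \<rho> J' \<otimes> \<rho>)) \<otimes> v_R H \<rho> J)"

end

end

theory Submission
  imports Defs
begin

text \<open>
  Write \<open>\<delta>(h) = h1 \<otimes> h2\<close> and \<open>(\<delta> \<otimes> H) (\<delta>(h)) = h11 \<otimes> h12 \<otimes> h2\<close>, where without coassociativity the two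
  orders of splitting must be kept apart, and let \<open>f * g = \<mu> \<cdot> (f \<otimes> g)\<close> also for \<open>f\<close> and \<open>g\<close> with
  arbitrary domains. This product is associative and unital, and \<open>\<delta>\<^sub>J = J' * \<delta> * J\<close> for the
  coproduct \<open>\<delta>\<^sub>J\<close> of the deformation. Put \<open>F = (\<delta> \<otimes> H) J * (J \<otimes> \<eta>)\<close> and let \<open>F'\<close> be its inverse. As
  \<open>\<delta> \<otimes> H\<close> is a morphism of monoids, \<open>(\<delta>\<^sub>J \<otimes> H) \<delta>\<^sub>J = F' * (\<delta> \<otimes> H) \<delta> * F\<close>; and the twist equation
  gives a second expression \<open>F = (H \<otimes> \<delta>) J * (\<eta> \<otimes> J)\<close>.

  The antipode laws say that \<open>h11 \<otimes> h12 \<rho>(h2)\<close> and \<open>h11 \<otimes> \<rho>(h12) h2\<close> both equal \<open>h \<otimes> 1\<close>. For the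
  deformation, two contractions of \<open>F' * (\<delta> \<otimes> H) \<delta> * F\<close> must therefore be computed:
  \<open>x \<otimes> y \<otimes> z \<mapsto> x \<otimes> y w \<rho>(z)\<close> (\<open>contract_last w\<close>) with \<open>w = v'\<close>, and \<open>x \<otimes> y \<otimes> z \<mapsto> x \<otimes> \<rho>(y) w z\<close>
  (\<open>contract_mid w\<close>) with \<open>w = v\<close>, where \<open>v\<close> and \<open>v'\<close> stand for \<open>v_R\<close> and \<open>v_R_inv\<close>. Since \<open>\<rho>\<close>
  reverses products, the contraction of a product \<open>p * q\<close> is nested: in \<open>y w \<rho>(z)\<close> the factors of \<open>q\<close>
  stand inside those of \<open>p\<close>, and in \<open>\<rho>(y) w z\<close> the factors of \<open>p\<close> inside those of \<open>q\<close>. So if the inner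
  factor contracts to \<open>f \<otimes> u\<close>, then the rest of the computation is the contraction of the outer one
  with \<open>u\<close> in place of \<open>w\<close> (\<open>contract_last_conv\<close>, \<open>contract_mid_conv\<close>). The three factors are then removed one at a time from the inside:
  for \<open>contract_last\<close> the element passes from \<open>v'\<close> through \<open>F\<close> to \<open>1\<close>, through \<open>(\<delta> \<otimes> H) \<delta>\<close> again
  to \<open>1\<close> by the antipode law of \<open>H\<close>, and through \<open>F'\<close> to \<open>v'\<close>; for \<open>contract_mid\<close> it passes
  from \<open>v\<close> through \<open>F'\<close> and \<open>(\<delta> \<otimes> H) \<delta>\<close> to \<open>1\<close>, and through \<open>F\<close> to \<open>v\<close>. The values on \<open>F\<close> and \<open>F'\<close> follow from
  their second expressions, in which \<open>H \<otimes> \<delta>\<close> contributes only a counit, and from \<open>J * J' = 1\<close>. The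
  outcome is \<open>h \<otimes> v'\<close> and \<open>h \<otimes> v\<close>, and \<open>v' * v = 1\<close> (\<open>v_R_inverse\<close>) finishes the proof.

  That \<open>\<rho>\<close> reverses products (\<open>antipode_antimultiplicative\<close>) holds for the reason familiar from Hopf
  algebras, in a form that needs no coassociativity: the antipode laws say that
  \<open>h \<otimes> k \<mapsto> h1 \<otimes> h2 k\<close> is bijective with inverse \<open>h \<otimes> k \<mapsto> h1 \<otimes> \<rho>(h2) k\<close>, and this bijection maps
  \<open>g1 h1 \<otimes> \<rho>(h2) \<rho>(g2)\<close> to \<open>g h \<otimes> 1\<close>.
\<close>

section \<open>Calculus in a strict symmetric monoidal category\<close>

context strict_symmetric_monoidal_category
begin

lemma hom_iff: "f \<in> hom C X Y \<longleftrightarrow> f \<in> mor C \<and> dom C f = X \<and> cod C f = Y"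
  by (simp add: hom_def)

lemma mor_id: "X \<in> ob C \<Longrightarrow> \<one> X \<in> mor C"
  and dom_id: "X \<in> ob C \<Longrightarrow> dom C (\<one> X) = X"
  and cod_id: "X \<in> ob C \<Longrightarrow> cod C (\<one> X) = X"
  using id_hom by (simp_all add: hom_iff)

lemma mor_comp: "f \<in> mor C \<Longrightarrow> g \<in> mor C \<Longrightarrow> cod C f = dom C g \<Longrightarrow> g \<cdot> f \<in> mor C"
  and dom_comp: "f \<in> mor C \<Longrightarrow> g \<in> mor C \<Longrightarrow> cod C f = dom C g \<Longrightarrow> dom C (g \<cdot> f) = dom C f"
  and cod_comp: "f \<in> mor C \<Longrightarrow> g \<in> mor C \<Longrightarrow> cod C f = dom C g \<Longrightarrow> cod C (g \<cdot> f) = cod C g"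
  using comp_hom[of f "dom C f" "cod C f" g "cod C g"] by (simp_all add: hom_iff)

lemma mor_tens: "f \<in> mor C \<Longrightarrow> g \<in> mor C \<Longrightarrow> f \<otimes> g \<in> mor C"
  and dom_tens: "f \<in> mor C \<Longrightarrow> g \<in> mor C \<Longrightarrow> dom C (f \<otimes> g) = dom C f \<odot> dom C g"
  and cod_tens: "f \<in> mor C \<Longrightarrow> g \<in> mor C \<Longrightarrow> cod C (f \<otimes> g) = cod C f \<odot> cod C g"
  using tens_hom[of f "dom C f" "cod C f" g "dom C g" "cod C g"] by (simp_all add: hom_iff)

lemma mor_symm: "X \<in> ob C \<Longrightarrow> Y \<in> ob C \<Longrightarrow> symm C X Y \<in> mor C"
  and dom_symm: "X \<in> ob C \<Longrightarrow> Y \<in> ob C \<Longrightarrow> dom C (symm C X Y) = X \<odot> Y"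
  and cod_symm: "X \<in> ob C \<Longrightarrow> Y \<in> ob C \<Longrightarrow> cod C (symm C X Y) = Y \<odot> X"
  using symm_hom by (simp_all add: hom_iff)

lemma comp_assoc': "f \<in> mor C \<Longrightarrow> g \<in> mor C \<Longrightarrow> h \<in> mor C \<Longrightarrow> cod C f = dom C g \<Longrightarrow>
    cod C g = dom C h \<Longrightarrow> (h \<cdot> g) \<cdot> f = h \<cdot> (g \<cdot> f)"
  using comp_assoc[of f "dom C f" "cod C f" g "cod C g" h "cod C h"] by (simp add: hom_iff)

lemma id_comp': "f \<in> mor C \<Longrightarrow> cod C f = Y \<Longrightarrow> \<one> Y \<cdot> f = f"
  using id_comp[of f "dom C f" Y] by (simp add: hom_iff)

lemma comp_id': "f \<in> mor C \<Longrightarrow> dom C f = X \<Longrightarrow> f \<cdot> \<one> X = f"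
  using comp_id[of f X "cod C f"] by (simp add: hom_iff)

lemma interchange': "f \<in> mor C \<Longrightarrow> g \<in> mor C \<Longrightarrow> f' \<in> mor C \<Longrightarrow> g' \<in> mor C \<Longrightarrow>
    cod C f = dom C g \<Longrightarrow> cod C f' = dom C g' \<Longrightarrow> (g \<otimes> g') \<cdot> (f \<otimes> f') = (g \<cdot> f) \<otimes> (g' \<cdot> f')"
  using interchange[of f "dom C f" "cod C f" g "cod C g" f' "dom C f'" "cod C f'" g' "cod C g'"]
  by (simp add: hom_iff)

text \<open>Composition and tensor product are normalised to nest to the right and identities to be tensor
  products of identities of smaller objects; the side conditions about domains and codomains are
  then decided by rewriting.\<close>

lemmas typing = dom_ob cod_ob mor_id dom_id cod_id mor_comp dom_comp cod_comp mor_tens dom_tens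
  cod_tens mor_symm dom_symm cod_symm unit_ob tens_ob tens_ob_assoc unit_tens_ob tens_unit_ob

lemmas basics = typing tens_assoc unit_tens tens_unit comp_assoc' id_comp' comp_id'
  tens_id[symmetric]

declare basics [simp]

lemma id_tens_comp [simp]:
  "X \<in> ob C \<Longrightarrow> Y \<in> ob C \<Longrightarrow> f \<in> mor C \<Longrightarrow> cod C f = X \<odot> Y \<Longrightarrow> (\<one> X \<otimes> \<one> Y) \<cdot> f = f"
  "X \<in> ob C \<Longrightarrow> Y \<in> ob C \<Longrightarrow> Z \<in> ob C \<Longrightarrow> f \<in> mor C \<Longrightarrow> cod C f = X \<odot> (Y \<odot> Z) \<Longrightarrow>
    (\<one> X \<otimes> (\<one> Y \<otimes> \<one> Z)) \<cdot> f = f"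
  using id_comp'[of f "X \<odot> Y"] id_comp'[of f "X \<odot> (Y \<odot> Z)"] by simp_all

lemma comp_id_tens [simp]:
  "X \<in> ob C \<Longrightarrow> Y \<in> ob C \<Longrightarrow> f \<in> mor C \<Longrightarrow> dom C f = X \<odot> Y \<Longrightarrow> f \<cdot> (\<one> X \<otimes> \<one> Y) = f"
  "X \<in> ob C \<Longrightarrow> Y \<in> ob C \<Longrightarrow> Z \<in> ob C \<Longrightarrow> f \<in> mor C \<Longrightarrow> dom C f = X \<odot> (Y \<odot> Z) \<Longrightarrow>
    f \<cdot> (\<one> X \<otimes> (\<one> Y \<otimes> \<one> Z)) = f"
  using comp_id'[of f "X \<odot> Y"] comp_id'[of f "X \<odot> (Y \<odot> Z)"] by simp_all

text \<open>Fusing two layers whose splittings into factors differ by one bracketing.\<close>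

lemma fuse_left: "f \<in> mor C \<Longrightarrow> g \<in> mor C \<Longrightarrow> h \<in> mor C \<Longrightarrow> d \<in> mor C \<Longrightarrow> y \<in> mor C \<Longrightarrow>
    cod C d = dom C f \<odot> dom C g \<Longrightarrow> cod C y = dom C h \<Longrightarrow>
    (f \<otimes> (g \<otimes> h)) \<cdot> (d \<otimes> y) = ((f \<otimes> g) \<cdot> d) \<otimes> (h \<cdot> y)"
  using interchange'[of d "f \<otimes> g" y h] by simp

lemma fuse_right: "f \<in> mor C \<Longrightarrow> g \<in> mor C \<Longrightarrow> d \<in> mor C \<Longrightarrow> e \<in> mor C \<Longrightarrow> y \<in> mor C \<Longrightarrow>
    dom C f = cod C d \<odot> cod C e \<Longrightarrow> cod C y = dom C g \<Longrightarrow>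
    (f \<otimes> g) \<cdot> (d \<otimes> (e \<otimes> y)) = (f \<cdot> (d \<otimes> e)) \<otimes> (g \<cdot> y)"
  using interchange'[of "d \<otimes> e" f y g] by simp

text \<open>A morphism out of the unit object needs no input and can be pushed down through any layer.\<close>

lemma point_right: "g \<in> mor C \<Longrightarrow> u \<in> mor C \<Longrightarrow> f \<in> mor C \<Longrightarrow> dom C u = \<K> \<Longrightarrow> cod C f = dom C g \<Longrightarrow>
    (g \<otimes> u) \<cdot> f = (g \<cdot> f) \<otimes> u"
  using interchange'[of f g "\<one> \<K>" u] by simp

lemma point_left: "g \<in> mor C \<Longrightarrow> u \<in> mor C \<Longrightarrow> f \<in> mor C \<Longrightarrow> dom C u = \<K> \<Longrightarrow> cod C f = dom C g \<Longrightarrow>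
    (u \<otimes> g) \<cdot> f = u \<otimes> (g \<cdot> f)"
  using interchange'[of "\<one> \<K>" u f g] by simp

text \<open>A known composite that is bracketed with a third morphism is hidden from the simplifier by the
  right-nested normal form; this rule brings it back.\<close>

lemma comp_reassoc: "f \<in> mor C \<Longrightarrow> g \<in> mor C \<Longrightarrow> h \<in> mor C \<Longrightarrow> cod C f = dom C g \<Longrightarrow>
    cod C g = dom C h \<Longrightarrow> h \<cdot> g = k \<Longrightarrow> h \<cdot> (g \<cdot> f) = k \<cdot> f"
  by (metis comp_assoc')

lemma symm_natural': "f \<in> mor C \<Longrightarrow> g \<in> mor C \<Longrightarrow> cod C f = X \<Longrightarrow> cod C g = Y \<Longrightarrow>
    symm C X Y \<cdot> (f \<otimes> g) = (g \<otimes> f) \<cdot> symm C (dom C f) (dom C g)"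
  using symm_natural[of f "dom C f" X g "dom C g" Y] by (simp add: hom_iff)

text \<open>The hexagon with two unit objects makes \<open>symm C X \<K>\<close> idempotent, and it is invertible.\<close>

lemma symm_unit_right: assumes X: "X \<in> ob C" shows "symm C X \<K> = \<one> X"
proof -
  let ?s = "symm C X \<K>" and ?t = "symm C \<K> X"
  have "?s = ?s \<cdot> ?s"
    using hexagon[OF X unit_ob unit_ob] X by simp
  then have "?t \<cdot> ?s = (?t \<cdot> ?s) \<cdot> ?s"
    using X by simp
  then show ?thesis
    using symm_symm[OF X unit_ob] X by simp
qed

lemma symm_unit_left: assumes X: "X \<in> ob C" shows "symm C \<K> X = \<one> X"
  using symm_symm[OF X unit_ob] X by (simp add: symm_unit_right)

lemma symm_point_right: "f \<in> mor C \<Longrightarrow> u \<in> mor C \<Longrightarrow> dom C u = \<K> \<Longrightarrow> cod C f = X \<Longrightarrow> cod C u = Y \<Longrightarrow>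
    symm C X Y \<cdot> (f \<otimes> u) = u \<otimes> f"
  by (simp add: symm_natural' symm_unit_right comp_id')

lemma symm_point_left: "f \<in> mor C \<Longrightarrow> u \<in> mor C \<Longrightarrow> dom C u = \<K> \<Longrightarrow> cod C f = Y \<Longrightarrow> cod C u = X \<Longrightarrow>
    symm C X Y \<cdot> (u \<otimes> f) = f \<otimes> u"
  by (simp add: symm_natural' symm_unit_left comp_id')

text \<open>The mirrored hexagon: both sides invert \<open>symm C Z (X \<odot> Y)\<close>, for which the hexagon axiom gives a
  decomposition.\<close>

lemma hexagon': assumes "X \<in> ob C" "Y \<in> ob C" "Z \<in> ob C"
  shows "symm C (X \<odot> Y) Z = (symm C X Z \<otimes> \<one> Y) \<cdot> (\<one> X \<otimes> symm C Y Z)"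
proof -
  let ?r = "(symm C X Z \<otimes> \<one> Y) \<cdot> (\<one> X \<otimes> symm C Y Z)"
    and ?s = "symm C Z (X \<odot> Y)" and ?t = "symm C (X \<odot> Y) Z"
  have "?r \<cdot> ?s = (symm C X Z \<otimes> \<one> Y) \<cdot>
      (((\<one> X \<otimes> symm C Y Z) \<cdot> (\<one> X \<otimes> symm C Z Y)) \<cdot> (symm C Z X \<otimes> \<one> Y))"
    using assms by (simp add: hexagon)
  also have "\<dots> = \<one> (Z \<odot> (X \<odot> Y))"
    using assms by (simp add: interchange' symm_symm)
  finally have "?t = (?r \<cdot> ?s) \<cdot> ?t"
    using assms by simp
  also have "\<dots> = ?r \<cdot> (?s \<cdot> ?t)"
    using assms by (simp del: tens_id[symmetric])
  also have "\<dots> = ?r"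
    using assms by (subst symm_symm) (simp_all add: interchange')
  finally show ?thesis .
qed

text \<open>Both sides carry \<open>Y \<odot> X \<odot> Z \<odot> W\<close> to \<open>X \<odot> W \<odot> Y \<odot> Z\<close>: either \<open>X\<close> crosses first, or \<open>W\<close> does. This is
  the wire diagram behind associativity of a tensor product of monoids.\<close>

lemma symm_exchange:
  assumes "X \<in> ob C" "Y \<in> ob C" "Z \<in> ob C" "W \<in> ob C"
  shows "(\<one> X \<otimes> symm C (Y \<odot> Z) W) \<cdot> (symm C Y X \<otimes> (\<one> Z \<otimes> \<one> W)) =
    (symm C Y (X \<odot> W) \<otimes> \<one> Z) \<cdot> (\<one> Y \<otimes> (\<one> X \<otimes> symm C Z W))"
proof -
  have "(\<one> X \<otimes> symm C (Y \<odot> Z) W) \<cdot> (symm C Y X \<otimes> (\<one> Z \<otimes> \<one> W)) =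
    (\<one> X \<otimes> (symm C Y W \<otimes> \<one> Z)) \<cdot> ((\<one> X \<otimes> (\<one> Y \<otimes> symm C Z W)) \<cdot> (symm C Y X \<otimes> (\<one> Z \<otimes> \<one> W)))"
    using assms interchange'[of "\<one> Y \<otimes> symm C Z W" "symm C Y W \<otimes> \<one> Z" "\<one> X" "\<one> X"]
      interchange'[of "\<one> X" "\<one> X" "\<one> Y \<otimes> symm C Z W" "symm C Y W \<otimes> \<one> Z"]
    by (simp add: hexagon' flip: comp_assoc')
  also have "(\<one> X \<otimes> (\<one> Y \<otimes> symm C Z W)) \<cdot> (symm C Y X \<otimes> (\<one> Z \<otimes> \<one> W)) =
      (symm C Y X \<otimes> (\<one> W \<otimes> \<one> Z)) \<cdot> (\<one> Y \<otimes> (\<one> X \<otimes> symm C Z W))"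
    using assms by (simp add: fuse_left fuse_right interchange')
  also have "(\<one> X \<otimes> (symm C Y W \<otimes> \<one> Z)) \<cdot> ((symm C Y X \<otimes> (\<one> W \<otimes> \<one> Z)) \<cdot> (\<one> Y \<otimes> (\<one> X \<otimes> symm C Z W))) =
    (symm C Y (X \<odot> W) \<otimes> \<one> Z) \<cdot> (\<one> Y \<otimes> (\<one> X \<otimes> symm C Z W))"
    using assms interchange'[of "symm C Y X \<otimes> \<one> W" "\<one> X \<otimes> symm C Y W" "\<one> Z" "\<one> Z"]
    by (simp add: hexagon flip: comp_assoc')
  finally show ?thesis .
qed

lemma yang_baxter:
  assumes "X \<in> ob C" "Y \<in> ob C" "Z \<in> ob C"
  shows "(\<one> Z \<otimes> symm C X Y) \<cdot> ((symm C X Z \<otimes> \<one> Y) \<cdot> (\<one> X \<otimes> symm C Y Z)) =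
    (symm C Y Z \<otimes> \<one> X) \<cdot> ((\<one> Y \<otimes> symm C X Z) \<cdot> (symm C X Y \<otimes> \<one> Z))"
proof -
  have "(\<one> Z \<otimes> symm C X Y) \<cdot> symm C (X \<odot> Y) Z = symm C (Y \<odot> X) Z \<cdot> (symm C X Y \<otimes> \<one> Z)"
    using assms symm_natural'[of "symm C X Y" "\<one> Z" "Y \<odot> X" Z] by simp
  then show ?thesis
    using assms by (simp add: hexagon')
qed

section \<open>Monoids and convolution\<close>

lemma monoid_typing [simp]:
  assumes "is_monoid C A"
  shows "obj A \<in> ob C" "\<eta> A \<in> mor C" "dom C (\<eta> A) = \<K>" "cod C (\<eta> A) = obj A"
    "\<mu> A \<in> mor C" "dom C (\<mu> A) = obj A \<odot> obj A" "cod C (\<mu> A) = obj A"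
  using assms by (simp_all add: is_monoid_def hom_iff)

lemma conv_typing [simp]:
  assumes "is_monoid C A" "f \<in> mor C" "g \<in> mor C" "cod C f = obj A" "cod C g = obj A"
  shows "convolution C A f g \<in> mor C" "dom C (convolution C A f g) = dom C f \<odot> dom C g"
    "cod C (convolution C A f g) = obj A"
  using assms by (simp_all add: convolution_def)

lemma conv_assoc:
  assumes A: "is_monoid C A" and "f \<in> mor C" "g \<in> mor C" "h \<in> mor C"
    "cod C f = obj A" "cod C g = obj A" "cod C h = obj A"
  shows "convolution C A (convolution C A f g) h = convolution C A f (convolution C A g h)"
proof -
  have "convolution C A (convolution C A f g) h = (\<mu> A \<cdot> (\<mu> A \<otimes> \<one> (obj A))) \<cdot> (f \<otimes> (g \<otimes> h))"
    using assms by (simp add: convolution_def fuse_right)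
  also have "\<dots> = (\<mu> A \<cdot> (\<one> (obj A) \<otimes> \<mu> A)) \<cdot> (f \<otimes> (g \<otimes> h))"
    using A unfolding is_monoid_def by simp
  also have "\<dots> = convolution C A f (convolution C A g h)"
    using assms by (simp add: convolution_def interchange')
  finally show ?thesis .
qed

lemma conv_unit_left [simp]:
  assumes A: "is_monoid C A" and f: "f \<in> mor C" "cod C f = obj A"
  shows "convolution C A (\<eta> A) f = f"
proof -
  have "convolution C A (\<eta> A) f = (\<mu> A \<cdot> (\<eta> A \<otimes> \<one> (obj A))) \<cdot> f"
    using assms by (simp add: convolution_def point_left)
  also have "\<dots> = f"
    using A f unfolding is_monoid_def by simp
  finally show ?thesis .
qed

lemma conv_unit_right [simp]:
  assumes A: "is_monoid C A" and f: "f \<in> mor C" "cod C f = obj A"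
  shows "convolution C A f (\<eta> A) = f"
proof -
  have "convolution C A f (\<eta> A) = (\<mu> A \<cdot> (\<one> (obj A) \<otimes> \<eta> A)) \<cdot> f"
    using assms by (simp add: convolution_def point_right)
  also have "\<dots> = f"
    using A f unfolding is_monoid_def by simp
  finally show ?thesis .
qed

lemma conv_comp:
  assumes "is_monoid C A" "f \<in> mor C" "g \<in> mor C" "cod C f = obj A" "cod C g = obj A"
    "x \<in> mor C" "y \<in> mor C" "cod C x = dom C f" "cod C y = dom C g"
  shows "convolution C A f g \<cdot> (x \<otimes> y) = convolution C A (f \<cdot> x) (g \<cdot> y)"
  using assms by (simp add: convolution_def interchange')

lemma conv_comp_left:
  assumes "is_monoid C A" "f \<in> mor C" "g \<in> mor C" "cod C f = obj A" "cod C g = obj A"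
    "x \<in> mor C" "cod C x = dom C f" "dom C g = \<K>"
  shows "convolution C A f g \<cdot> x = convolution C A (f \<cdot> x) g"
  using assms by (simp add: convolution_def point_right)

lemma conv_comp_right:
  assumes "is_monoid C A" "f \<in> mor C" "g \<in> mor C" "cod C f = obj A" "cod C g = obj A"
    "x \<in> mor C" "cod C x = dom C g" "dom C f = \<K>"
  shows "convolution C A f g \<cdot> x = convolution C A f (g \<cdot> x)"
  using assms by (simp add: convolution_def point_left)

text \<open>Lets the multiplication take part in computations with the associativity of convolution.\<close>

lemma mult_eq_conv: "is_monoid C A \<Longrightarrow> \<mu> A = convolution C A (\<one> (obj A)) (\<one> (obj A))"
  by (simp add: convolution_def comp_id')

section \<open>Opposite monoids and tensor products of monoids\<close>

definition op_monoid :: "('o, 'm, 'z) monoid_data_scheme \<Rightarrow> ('o, 'm) monoid_data" where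
  "op_monoid A = \<lparr> obj = obj A, eta = \<eta> A, mult = \<mu> A \<cdot> symm C (obj A) (obj A) \<rparr>"

lemma op_simps [simp]: "obj (op_monoid A) = obj A" "\<eta> (op_monoid A) = \<eta> A"
    "\<mu> (op_monoid A) = \<mu> A \<cdot> symm C (obj A) (obj A)"
  by (simp_all add: op_monoid_def)

text \<open>Reversing three factors from the left or from the right is the same permutation
  (\<open>yang_baxter\<close>), so associativity is inherited.\<close>

lemma op_is_monoid [simp]:
  assumes A: "is_monoid C A"
  shows "is_monoid C (op_monoid A)"
proof -
  let ?a = "\<one> (obj A)" and ?c = "symm C (obj A) (obj A)"
  have ass: "\<mu> A \<cdot> (\<mu> A \<otimes> ?a) = \<mu> A \<cdot> (?a \<otimes> \<mu> A)"
    and l: "\<mu> A \<cdot> (\<eta> A \<otimes> ?a) = ?a" and r: "\<mu> A \<cdot> (?a \<otimes> \<eta> A) = ?a"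
    using A by (simp_all add: is_monoid_def)
  have 1: "?c \<cdot> ((\<mu> A \<cdot> ?c) \<otimes> ?a) = (?a \<otimes> \<mu> A) \<cdot> ((?a \<otimes> ?c) \<cdot> ((?c \<otimes> ?a) \<cdot> (?a \<otimes> ?c)))"
  proof -
    have "?c \<cdot> ((\<mu> A \<cdot> ?c) \<otimes> ?a) = (?a \<otimes> (\<mu> A \<cdot> ?c)) \<cdot> symm C (obj A \<odot> obj A) (obj A)"
      using A symm_natural'[of "\<mu> A \<cdot> ?c" ?a "obj A" "obj A"] by simp
    also have "?a \<otimes> (\<mu> A \<cdot> ?c) = (?a \<otimes> \<mu> A) \<cdot> (?a \<otimes> ?c)"
      using A by (simp add: interchange')
    finally show ?thesis using A by (simp add: hexagon')
  qed
  have 2: "?c \<cdot> (?a \<otimes> (\<mu> A \<cdot> ?c)) = (\<mu> A \<otimes> ?a) \<cdot> ((?c \<otimes> ?a) \<cdot> ((?a \<otimes> ?c) \<cdot> (?c \<otimes> ?a)))"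
  proof -
    have "?c \<cdot> (?a \<otimes> (\<mu> A \<cdot> ?c)) = ((\<mu> A \<cdot> ?c) \<otimes> ?a) \<cdot> symm C (obj A) (obj A \<odot> obj A)"
      using A symm_natural'[of ?a "\<mu> A \<cdot> ?c" "obj A" "obj A"] by simp
    also have "(\<mu> A \<cdot> ?c) \<otimes> ?a = (\<mu> A \<otimes> ?a) \<cdot> (?c \<otimes> ?a)"
      using A by (simp add: interchange')
    finally show ?thesis using A by (simp add: hexagon)
  qed
  have "\<mu> A \<cdot> ((?a \<otimes> \<mu> A) \<cdot> ((?a \<otimes> ?c) \<cdot> ((?c \<otimes> ?a) \<cdot> (?a \<otimes> ?c)))) =
      \<mu> A \<cdot> ((\<mu> A \<otimes> ?a) \<cdot> ((?a \<otimes> ?c) \<cdot> ((?c \<otimes> ?a) \<cdot> (?a \<otimes> ?c))))"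
    using A ass by (simp flip: comp_assoc')
  then have "\<mu> A \<cdot> (?c \<cdot> ((\<mu> A \<cdot> ?c) \<otimes> ?a)) = \<mu> A \<cdot> (?c \<cdot> (?a \<otimes> (\<mu> A \<cdot> ?c)))"
    using A unfolding 1 2 by (simp add: yang_baxter)
  then show ?thesis
    using A l r unfolding is_monoid_def[of C "op_monoid A"]
    by (simp add: hom_iff symm_point_left symm_point_right)
qed

lemma tensor_simps [simp]: "obj (tensor_monoid C A B) = obj A \<odot> obj B"
    "\<eta> (tensor_monoid C A B) = \<eta> A \<otimes> \<eta> B"
  by (simp_all add: tensor_monoid_def)

lemma tensor_mult: "is_monoid C A \<Longrightarrow> is_monoid C B \<Longrightarrow> \<mu> (tensor_monoid C A B) =
    (\<mu> A \<otimes> \<mu> B) \<cdot> (\<one> (obj A) \<otimes> (symm C (obj B) (obj A) \<otimes> \<one> (obj B)))"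
  by (simp add: tensor_monoid_def)

lemma tensor_mult_typing [simp]:
  assumes "is_monoid C A" "is_monoid C B"
  shows "\<mu> (tensor_monoid C A B) \<in> mor C"
    "dom C (\<mu> (tensor_monoid C A B)) = obj A \<odot> (obj B \<odot> (obj A \<odot> obj B))"
    "cod C (\<mu> (tensor_monoid C A B)) = obj A \<odot> obj B"
  using assms by (simp_all add: tensor_mult)

text \<open>The two inner factors have to be exchanged, which costs nothing if one of them is a point, that
  is, a morphism from the unit object.\<close>

lemma conv_tens:
  assumes "is_monoid C A" "is_monoid C B"
    "f \<in> mor C" "g \<in> mor C" "cod C f = obj A" "cod C g = obj A"
    "f' \<in> mor C" "g' \<in> mor C" "cod C f' = obj B" "cod C g' = obj B"
    and "dom C f' = \<K> \<or> dom C g = \<K>"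
  shows "convolution C (tensor_monoid C A B) (f \<otimes> f') (g \<otimes> g') =
    convolution C A f g \<otimes> convolution C B f' g'"
proof -
  have "symm C (obj B) (obj A) \<cdot> (f' \<otimes> g) = g \<otimes> f'"
    using assms by (auto simp: symm_point_left symm_point_right)
  then show ?thesis
    using assms by (simp add: convolution_def tensor_mult interchange' fuse_left fuse_right)
qed

lemma tensor_is_monoid [simp]:
  assumes A: "is_monoid C A" and B: "is_monoid C B"
  shows "is_monoid C (tensor_monoid C A B)"
proof -
  let ?a = "\<one> (obj A)" and ?b = "\<one> (obj B)" and ?c = "symm C (obj B) (obj A)"
  let ?M = "\<mu> (tensor_monoid C A B)"
  let ?P = "\<one> (obj A) \<otimes> (((\<one> (obj A) \<otimes> symm C (obj B \<odot> obj B) (obj A)) \<cdot>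
    (?c \<otimes> (?b \<otimes> ?a))) \<otimes> ?b)"
  let ?Q = "\<one> (obj A) \<otimes> (((symm C (obj B) (obj A \<odot> obj A) \<otimes> ?b) \<cdot>
    (?b \<otimes> (?a \<otimes> ?c))) \<otimes> ?b)"
  (* ?P and ?Q are what is left of the symmetries once they have been moved past the
     multiplications, for the two bracketings of a triple product. *)
  have assA: "\<mu> A \<cdot> (\<mu> A \<otimes> ?a) = \<mu> A \<cdot> (?a \<otimes> \<mu> A)" 
    and assB: "\<mu> B \<cdot> (\<mu> B \<otimes> ?b) = \<mu> B \<cdot> (?b \<otimes> \<mu> B)"
    using A B by (simp_all add: is_monoid_def)
  have cL: "?c \<cdot> (\<mu> B \<otimes> ?a) = (?a \<otimes> \<mu> B) \<cdot> symm C (obj B \<odot> obj B) (obj A)"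
    using A B by (simp add: symm_natural')
  have cR: "?c \<cdot> (?b \<otimes> \<mu> A) = (\<mu> A \<otimes> ?b) \<cdot> symm C (obj B) (obj A \<odot> obj A)"
    using A B by (simp add: symm_natural')
  have fP: "(?a \<otimes> (symm C (obj B \<odot> obj B) (obj A) \<otimes> ?b)) \<cdot> (?c \<otimes> (?b \<otimes> (?a \<otimes> ?b))) =
      ((?a \<otimes> symm C (obj B \<odot> obj B) (obj A)) \<cdot> (?c \<otimes> (?b \<otimes> ?a))) \<otimes> ?b"
    using A B interchange'[of "?c \<otimes> (?b \<otimes> ?a)" "?a \<otimes> symm C (obj B \<odot> obj B) (obj A)" ?b ?b] by simp
  have "?M \<cdot> (?M \<otimes> (?a \<otimes> ?b)) = (\<mu> A \<otimes> \<mu> B) \<cdot>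
      ((?a \<otimes> (?c \<otimes> ?b)) \<cdot> (((\<mu> A \<otimes> \<mu> B) \<otimes> (?a \<otimes> ?b)) \<cdot> ((?a \<otimes> (?c \<otimes> ?b)) \<otimes> (?a \<otimes> ?b))))"
    using A B interchange'[of "?a \<otimes> (?c \<otimes> ?b)" "\<mu> A \<otimes> \<mu> B" "?a \<otimes> ?b" "?a \<otimes> ?b"]
    by (simp add: tensor_mult)
  also have "\<dots> = (\<mu> A \<otimes> \<mu> B) \<cdot>
      (((?a \<otimes> (?c \<otimes> ?b)) \<cdot> ((\<mu> A \<otimes> \<mu> B) \<otimes> (?a \<otimes> ?b))) \<cdot> ((?a \<otimes> (?c \<otimes> ?b)) \<otimes> (?a \<otimes> ?b)))"
    using A B by simp
  also have "(?a \<otimes> (?c \<otimes> ?b)) \<cdot> ((\<mu> A \<otimes> \<mu> B) \<otimes> (?a \<otimes> ?b)) = \<mu> A \<otimes> ((?c \<cdot> (\<mu> B \<otimes> ?a)) \<otimes> ?b)"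
    using A B by (simp add: interchange' fuse_left fuse_right)
  also have "\<mu> A \<otimes> ((?c \<cdot> (\<mu> B \<otimes> ?a)) \<otimes> ?b) = 
      ((\<mu> A \<otimes> ?a) \<otimes> (\<mu> B \<otimes> ?b)) \<cdot> ((?a \<otimes> ?a) \<otimes> (symm C (obj B \<odot> obj B) (obj A) \<otimes> ?b))"
    unfolding cL using A B by (simp add: interchange' fuse_left fuse_right)
  also have "(\<mu> A \<otimes> \<mu> B) \<cdot> (((\<mu> A \<otimes> ?a) \<otimes> (\<mu> B \<otimes> ?b)) \<cdot> ((?a \<otimes> ?a) \<otimes> (symm C (obj B \<odot> obj B) (obj A) \<otimes> ?b)) \<cdot>
      ((?a \<otimes> (?c \<otimes> ?b)) \<otimes> (?a \<otimes> ?b))) = 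
      ((\<mu> A \<otimes> \<mu> B) \<cdot> ((\<mu> A \<otimes> ?a) \<otimes> (\<mu> B \<otimes> ?b))) \<cdot> (((?a \<otimes> ?a) \<otimes> (symm C (obj B \<odot> obj B) (obj A) \<otimes> ?b)) \<cdot> ((?a \<otimes> (?c \<otimes> ?b)) \<otimes> (?a \<otimes> ?b)))"
    using A B by (simp)
  also have "((?a \<otimes> ?a) \<otimes> (symm C (obj B \<odot> obj B) (obj A) \<otimes> ?b)) \<cdot> ((?a \<otimes> (?c \<otimes> ?b)) \<otimes> (?a \<otimes> ?b)) = ?P"
    using A B by (simp add: interchange' fuse_left fuse_right fP)
  also have "(\<mu> A \<otimes> \<mu> B) \<cdot> ((\<mu> A \<otimes> ?a) \<otimes> (\<mu> B \<otimes> ?b)) =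
      (\<mu> A \<otimes> \<mu> B) \<cdot> ((?a \<otimes> \<mu> A) \<otimes> (?b \<otimes> \<mu> B))"
    using A B interchange'[of "\<mu> A \<otimes> ?a" "\<mu> A" "\<mu> B \<otimes> ?b" "\<mu> B"]
       interchange'[of "?a \<otimes> \<mu> A" "\<mu> A" "?b \<otimes> \<mu> B" "\<mu> B"] by (simp add: assA assB)
  also have "?P = ?Q"
    using A B symm_exchange[of "obj A" "obj B" "obj B" "obj A"] by simp
  finally have L: "?M \<cdot> (?M \<otimes> (?a \<otimes> ?b)) = ((\<mu> A \<otimes> \<mu> B) \<cdot> ((?a \<otimes> \<mu> A) \<otimes> (?b \<otimes> \<mu> B))) \<cdot> ?Q" .
  have fQ: "(symm C (obj B) (obj A \<odot> obj A) \<otimes> (?b \<otimes> ?b)) \<cdot> (?b \<otimes> (?a \<otimes> (?c \<otimes> ?b))) =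
      ((symm C (obj B) (obj A \<odot> obj A) \<otimes> ?b) \<cdot> (?b \<otimes> (?a \<otimes> ?c))) \<otimes> ?b"
    using A B interchange'[of "?b \<otimes> (?a \<otimes> ?c)" "symm C (obj B) (obj A \<odot> obj A) \<otimes> ?b" ?b ?b] by simp
  have "?M \<cdot> ((?a \<otimes> ?b) \<otimes> ?M) = (\<mu> A \<otimes> \<mu> B) \<cdot>
      ((?a \<otimes> (?c \<otimes> ?b)) \<cdot> (((?a \<otimes> ?b) \<otimes> (\<mu> A \<otimes> \<mu> B)) \<cdot> ((?a \<otimes> ?b) \<otimes> (?a \<otimes> (?c \<otimes> ?b)))))"
    using A B interchange'[of "?a \<otimes> ?b" "?a \<otimes> ?b" "?a \<otimes> (?c \<otimes> ?b)" "\<mu> A \<otimes> \<mu> B"]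
    by (simp add: tensor_mult)
  also have "\<dots> = (\<mu> A \<otimes> \<mu> B) \<cdot>
      (((?a \<otimes> (?c \<otimes> ?b)) \<cdot> ((?a \<otimes> ?b) \<otimes> (\<mu> A \<otimes> \<mu> B))) \<cdot> ((?a \<otimes> ?b) \<otimes> (?a \<otimes> (?c \<otimes> ?b))))"
    using A B by simp
  also have "(?a \<otimes> (?c \<otimes> ?b)) \<cdot> ((?a \<otimes> ?b) \<otimes> (\<mu> A \<otimes> \<mu> B)) = ?a \<otimes> ((?c \<cdot> (?b \<otimes> \<mu> A)) \<otimes> \<mu> B)"
    using A B by (simp add: interchange' fuse_left fuse_right)
  also have "?a \<otimes> ((?c \<cdot> (?b \<otimes> \<mu> A)) \<otimes> \<mu> B) =
      ((?a \<otimes> \<mu> A) \<otimes> (?b \<otimes> \<mu> B)) \<cdot> (?a \<otimes> (symm C (obj B) (obj A \<odot> obj A) \<otimes> (?b \<otimes> ?b)))"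
    unfolding cR using A B by (simp add: interchange' fuse_left fuse_right)
  also have "(\<mu> A \<otimes> \<mu> B) \<cdot> (((?a \<otimes> \<mu> A) \<otimes> (?b \<otimes> \<mu> B)) \<cdot> (?a \<otimes> (symm C (obj B) (obj A \<odot> obj A) \<otimes> (?b \<otimes> ?b))) \<cdot>
      ((?a \<otimes> ?b) \<otimes> (?a \<otimes> (?c \<otimes> ?b)))) = 
      ((\<mu> A \<otimes> \<mu> B) \<cdot> ((?a \<otimes> \<mu> A) \<otimes> (?b \<otimes> \<mu> B))) \<cdot> ((?a \<otimes> (symm C (obj B) (obj A \<odot> obj A) \<otimes> (?b \<otimes> ?b))) \<cdot> ((?a \<otimes> ?b) \<otimes> (?a \<otimes> (?c \<otimes> ?b))))"
    using A B by (simp)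
  also have "(?a \<otimes> (symm C (obj B) (obj A \<odot> obj A) \<otimes> (?b \<otimes> ?b))) \<cdot> ((?a \<otimes> ?b) \<otimes> (?a \<otimes> (?c \<otimes> ?b))) = ?Q"
    using A B by (simp add: interchange' fuse_left fuse_right fQ)
  finally have "?M \<cdot> (?M \<otimes> (?a \<otimes> ?b)) = ?M \<cdot> ((?a \<otimes> ?b) \<otimes> ?M)"
    using L by simp
  moreover have "convolution C (tensor_monoid C A B) (\<eta> A \<otimes> \<eta> B) (?a \<otimes> ?b) = ?a \<otimes> ?b"
    using A B by (subst conv_tens) simp_all
  moreover have "convolution C (tensor_monoid C A B) (?a \<otimes> ?b) (\<eta> A \<otimes> \<eta> B) = ?a \<otimes> ?b"
    using A B by (subst conv_tens) simp_all
  ultimately show ?thesis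
    using A B unfolding is_monoid_def[of C "tensor_monoid C A B"] convolution_def
    by (simp add: hom_iff)
qed

text \<open>The two products permute \<open>a b d a' b' d'\<close> in the same way, so that they are equal morphisms; iterated
  tensor products of monoids may be read with either bracketing.\<close>

lemma tensor_monoid_assoc:
  assumes A: "is_monoid C A" and B: "is_monoid C B" and D: "is_monoid C D"
  shows "tensor_monoid C (tensor_monoid C A B) D = tensor_monoid C A (tensor_monoid C B D)"
proof -
  let ?a = "\<one> (obj A)" and ?b = "\<one> (obj B)" and ?d = "\<one> (obj D)"
  let ?L = "(symm C (obj B) (obj A) \<otimes> (?b \<otimes> ?d)) \<cdot> (?b \<otimes> symm C (obj D) (obj A \<odot> obj B))"
  let ?R = "(?a \<otimes> (?b \<otimes> symm C (obj D) (obj B))) \<cdot> (symm C (obj B \<odot> obj D) (obj A) \<otimes> ?b)"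
  let ?s = "symm C (obj B) (obj A)" and ?t = "symm C (obj D) (obj B)" and ?r = "symm C (obj D) (obj A)"
  have "?L = (?s \<otimes> (?b \<otimes> ?d)) \<cdot> ((?b \<otimes> (?a \<otimes> ?t)) \<cdot> (?b \<otimes> (?r \<otimes> ?b)))"
    using A B D interchange'[of ?b ?b "?r \<otimes> ?b" "?a \<otimes> ?t"] by (simp add: hexagon)
  also have "\<dots> = ((?s \<otimes> (?b \<otimes> ?d)) \<cdot> (?b \<otimes> (?a \<otimes> ?t))) \<cdot> (?b \<otimes> (?r \<otimes> ?b))"
    using A B D by simp
  also have "(?s \<otimes> (?b \<otimes> ?d)) \<cdot> (?b \<otimes> (?a \<otimes> ?t)) = (?a \<otimes> (?b \<otimes> ?t)) \<cdot> (?s \<otimes> (?d \<otimes> ?b))"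
    using A B D by (simp add: fuse_left fuse_right)
  also have "\<dots> \<cdot> (?b \<otimes> (?r \<otimes> ?b)) = ?R"
    using A B D interchange'[of "?b \<otimes> ?r" "?s \<otimes> ?d" ?b ?b] by (simp add: hexagon')
  finally have LR: "?L = ?R" .
  let ?m = "\<mu> A \<otimes> (\<mu> B \<otimes> \<mu> D)"
    and ?u = "symm C (obj D) (obj A \<odot> obj B)" and ?v = "symm C (obj B \<odot> obj D) (obj A)"
  have "\<mu> (tensor_monoid C (tensor_monoid C A B) D) =
      ?m \<cdot> ((?a \<otimes> (?s \<otimes> (?b \<otimes> (?d \<otimes> ?d)))) \<cdot> (?a \<otimes> (?b \<otimes> (?u \<otimes> ?d))))"
    using A B D interchange'[of "?a \<otimes> (?s \<otimes> ?b)" "\<mu> A \<otimes> \<mu> B" "?d \<otimes> ?d" "\<mu> D"]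
    by (simp add: tensor_mult flip: comp_assoc')
  also have "(?a \<otimes> (?s \<otimes> (?b \<otimes> (?d \<otimes> ?d)))) \<cdot> (?a \<otimes> (?b \<otimes> (?u \<otimes> ?d))) = ?a \<otimes> (?L \<otimes> ?d)"
    using A B D interchange'[of ?a ?a "?b \<otimes> (?u \<otimes> ?d)" "?s \<otimes> (?b \<otimes> (?d \<otimes> ?d))"]
      interchange'[of "?b \<otimes> ?u" "?s \<otimes> (?b \<otimes> ?d)" ?d ?d] by simp
  also have "?a \<otimes> (?L \<otimes> ?d) = (?a \<otimes> (?a \<otimes> (?b \<otimes> (?t \<otimes> ?d)))) \<cdot> (?a \<otimes> (?v \<otimes> (?b \<otimes> ?d)))"
    unfolding LR using A B D interchange'[of ?a ?a "?v \<otimes> (?b \<otimes> ?d)" "?a \<otimes> (?b \<otimes> (?t \<otimes> ?d))"]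
      interchange'[of "?v \<otimes> ?b" "?a \<otimes> (?b \<otimes> ?t)" ?d ?d] by simp
  also have "?m \<cdot> \<dots> = \<mu> (tensor_monoid C A (tensor_monoid C B D))"
    using A B D interchange'[of "?a \<otimes> ?a" "\<mu> A" "?b \<otimes> (?t \<otimes> ?d)" "\<mu> B \<otimes> \<mu> D"]
    by (simp add: tensor_mult flip: comp_assoc')
  finally show ?thesis
    using A B D by (simp add: tensor_monoid_def)
qed

definition monoid_hom :: "('o, 'm, 'y) monoid_data_scheme \<Rightarrow> ('o, 'm, 'z) monoid_data_scheme \<Rightarrow> 'm \<Rightarrow> bool" where
  "monoid_hom A B f \<longleftrightarrow> f \<in> hom C (obj A) (obj B) \<and> f \<cdot> \<mu> A = \<mu> B \<cdot> (f \<otimes> f) \<and> f \<cdot> \<eta> A = \<eta> B"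

lemma monoid_homD:
  assumes "monoid_hom A B f"
  shows "f \<in> mor C" "dom C f = obj A" "cod C f = obj B" "f \<cdot> \<eta> A = \<eta> B"
    "f \<cdot> \<mu> A = \<mu> B \<cdot> (f \<otimes> f)"
  using assms by (simp_all add: monoid_hom_def hom_iff)

lemma hom_conv:
  assumes f: "monoid_hom A B f" and "is_monoid C A" "is_monoid C B"
    and "g \<in> mor C" "h \<in> mor C" "cod C g = obj A" "cod C h = obj A"
  shows "f \<cdot> convolution C A g h = convolution C B (f \<cdot> g) (f \<cdot> h)"
proof -
  note [simp] = monoid_homD(1-4)[OF f]
  have "f \<cdot> convolution C A g h = (f \<cdot> \<mu> A) \<cdot> (g \<otimes> h)"
    using assms by (simp add: convolution_def)
  also have "\<dots> = convolution C B (f \<cdot> g) (f \<cdot> h)"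
    unfolding monoid_homD(5)[OF f] using assms by (simp add: convolution_def interchange')
  finally show ?thesis .
qed

lemma id_monoid_hom: "is_monoid C A \<Longrightarrow> monoid_hom A A (\<one> (obj A))"
  by (simp add: monoid_hom_def hom_iff)

text \<open>The middle symmetry is natural, so it lets \<open>f\<close> and \<open>g\<close> pass.\<close>

lemma tensor_monoid_hom:
  assumes M: "is_monoid C A" "is_monoid C B" "is_monoid C A'" "is_monoid C B'"
    and f: "monoid_hom A A' f" and g: "monoid_hom B B' g"
  shows "monoid_hom (tensor_monoid C A B) (tensor_monoid C A' B') (f \<otimes> g)"
proof -
  note [simp] = monoid_homD(1-4)[OF f] monoid_homD(1-4)[OF g]
  let ?c = "symm C (obj B) (obj A)" and ?c' = "symm C (obj B') (obj A')"
  have 1: "?c' \<cdot> (g \<otimes> f) = (f \<otimes> g) \<cdot> ?c"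
    using M by (simp add: symm_natural')
  have "(f \<otimes> g) \<cdot> \<mu> (tensor_monoid C A B) =
      ((f \<otimes> g) \<cdot> (\<mu> A \<otimes> \<mu> B)) \<cdot> (\<one> (obj A) \<otimes> (?c \<otimes> \<one> (obj B)))"
    using M by (simp add: tensor_mult)
  also have "(f \<otimes> g) \<cdot> (\<mu> A \<otimes> \<mu> B) = (\<mu> A' \<otimes> \<mu> B') \<cdot> ((f \<otimes> f) \<otimes> (g \<otimes> g))"
    using M monoid_homD(5)[OF f] monoid_homD(5)[OF g]
      interchange'[of "\<mu> A" f "\<mu> B" g] interchange'[of "f \<otimes> f" "\<mu> A'" "g \<otimes> g" "\<mu> B'"]
    by simp
  also have "\<dots> \<cdot> (\<one> (obj A) \<otimes> (?c \<otimes> \<one> (obj B))) =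
      (\<mu> A' \<otimes> \<mu> B') \<cdot> ((f \<otimes> (f \<otimes> (g \<otimes> g))) \<cdot> (\<one> (obj A) \<otimes> (?c \<otimes> \<one> (obj B))))"
    using M by simp
  also have "(f \<otimes> (f \<otimes> (g \<otimes> g))) \<cdot> (\<one> (obj A) \<otimes> (?c \<otimes> \<one> (obj B))) = f \<otimes> ((?c' \<cdot> (g \<otimes> f)) \<otimes> g)"
    unfolding 1 using M by (simp add: interchange' fuse_left)
  also have "\<dots> = (\<one> (obj A') \<otimes> (?c' \<otimes> \<one> (obj B'))) \<cdot> (f \<otimes> (g \<otimes> (f \<otimes> g)))"
    using M by (simp add: interchange' fuse_right)
  also have "(\<mu> A' \<otimes> \<mu> B') \<cdot> \<dots> = \<mu> (tensor_monoid C A' B') \<cdot> ((f \<otimes> g) \<otimes> (f \<otimes> g))"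
    using M by (simp add: tensor_mult)
  finally show ?thesis
    using M by (simp add: monoid_hom_def hom_iff interchange')
qed

section \<open>Contracting two tensor factors of a product\<close>

text \<open>On elements, \<open>y \<otimes> z \<mapsto> y w z\<close>.\<close>

definition sandwich :: "('o, 'm, 'z) monoid_data_scheme \<Rightarrow> 'm \<Rightarrow> 'm" where
  "sandwich B w = convolution C B (\<one> (obj B)) (convolution C B w (\<one> (obj B)))"

lemma sandwich_typing [simp]:
  assumes "is_monoid C B" "w \<in> mor C" "dom C w = \<K>" "cod C w = obj B"
  shows "sandwich B w \<in> mor C" "dom C (sandwich B w) = obj B \<odot> obj B" "cod C (sandwich B w) = obj B"
  using assms by (simp_all add: sandwich_def)

lemma sandwich_comp:
  assumes "is_monoid C B" "w \<in> mor C" "dom C w = \<K>" "cod C w = obj B"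
    "f \<in> mor C" "g \<in> mor C" "cod C f = obj B" "cod C g = obj B"
  shows "sandwich B w \<cdot> (f \<otimes> g) = convolution C B f (convolution C B w g)"
  using assms by (simp add: sandwich_def conv_comp conv_comp_right)

lemma sandwich_unit: "is_monoid C B \<Longrightarrow> sandwich B (\<eta> B) = \<mu> B"
  by (simp add: sandwich_def mult_eq_conv)

lemma conv_op:
  assumes "is_monoid C A" "f \<in> mor C" "g \<in> mor C" "cod C f = obj A" "cod C g = obj A"
  shows "convolution C (op_monoid A) f g = convolution C A g f \<cdot> symm C (dom C f) (dom C g)"
  using assms by (simp add: convolution_def symm_natural')

text \<open>In \<open>B \<otimes> op_monoid B\<close> the product of \<open>y \<otimes> z\<close> and \<open>y' \<otimes> z'\<close> is \<open>y y' \<otimes> z' z\<close>, and sandwiching \<open>w\<close> gives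
  \<open>y (y' w z') z\<close>: the second factor is contracted first and then enclosed in the first one.\<close>

lemma sandwich_op_right:
  assumes B: "is_monoid C B" and w: "w \<in> mor C" "dom C w = \<K>" "cod C w = obj B"
  shows "sandwich B w \<cdot> \<mu> (tensor_monoid C B (op_monoid B)) =
    convolution C B (\<one> (obj B)) (convolution C (op_monoid B) (\<one> (obj B)) (sandwich B w))"
proof -
  let ?b = "\<one> (obj B)" and ?c = "symm C (obj B) (obj B)" and ?s = "sandwich B w"
  have "?s \<cdot> \<mu> (tensor_monoid C B (op_monoid B)) =
      ?s \<cdot> (((\<mu> B \<otimes> \<mu> B) \<cdot> ((?b \<otimes> ?b) \<otimes> ?c)) \<cdot> (?b \<otimes> (?c \<otimes> ?b)))"
    using B w interchange'[of "?b \<otimes> ?b" "\<mu> B" ?c "\<mu> B"] by (simp add: tensor_mult)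
  also have "\<dots> = (?s \<cdot> (\<mu> B \<otimes> \<mu> B)) \<cdot> (((?b \<otimes> ?b) \<otimes> ?c) \<cdot> (?b \<otimes> (?c \<otimes> ?b)))"
    using B w by simp
  also have "?s \<cdot> (\<mu> B \<otimes> \<mu> B) = convolution C B (\<mu> B) (convolution C B w (\<mu> B))"
    using B w by (simp add: sandwich_comp)
  also have "\<dots> = convolution C B ?b (convolution C B ?s ?b)"
    using B w by (simp add: mult_eq_conv[OF B] sandwich_def conv_assoc)
  also have "((?b \<otimes> ?b) \<otimes> ?c) \<cdot> (?b \<otimes> (?c \<otimes> ?b)) = ?b \<otimes> symm C (obj B) (obj B \<odot> obj B)"
    using B by (simp add: hexagon interchange')
  also have "convolution C B ?b (convolution C B ?s ?b) \<cdot> \<dots> =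
      convolution C B ?b (convolution C B ?s ?b \<cdot> symm C (obj B) (obj B \<odot> obj B))"
    using B w conv_comp[of B ?b "convolution C B ?s ?b" ?b "symm C (obj B) (obj B \<odot> obj B)"] by simp
  finally show ?thesis
    using B w by (simp add: conv_op)
qed

text \<open>The mirror image: in \<open>op_monoid B \<otimes> B\<close> the product is \<open>y' y \<otimes> z z'\<close>, and the first factor ends up
  inside.\<close>

lemma sandwich_op_left:
  assumes B: "is_monoid C B" and w: "w \<in> mor C" "dom C w = \<K>" "cod C w = obj B"
  shows "sandwich B w \<cdot> \<mu> (tensor_monoid C (op_monoid B) B) =
    convolution C B (convolution C (op_monoid B) (sandwich B w) (\<one> (obj B))) (\<one> (obj B))"
proof -
  let ?b = "\<one> (obj B)" and ?c = "symm C (obj B) (obj B)" and ?s = "sandwich B w"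
  have "?s \<cdot> \<mu> (tensor_monoid C (op_monoid B) B) =
      ?s \<cdot> (((\<mu> B \<otimes> \<mu> B) \<cdot> (?c \<otimes> (?b \<otimes> ?b))) \<cdot> (?b \<otimes> (?c \<otimes> ?b)))"
    using B w interchange'[of ?c "\<mu> B" "?b \<otimes> ?b" "\<mu> B"] by (simp add: tensor_mult)
  also have "\<dots> = (?s \<cdot> (\<mu> B \<otimes> \<mu> B)) \<cdot> ((?c \<otimes> (?b \<otimes> ?b)) \<cdot> (?b \<otimes> (?c \<otimes> ?b)))"
    using B w by simp
  also have "?s \<cdot> (\<mu> B \<otimes> \<mu> B) = convolution C B (\<mu> B) (convolution C B w (\<mu> B))"
    using B w by (simp add: sandwich_comp)
  also have "\<dots> = convolution C B (convolution C B ?b ?s) ?b"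
    using B w by (simp add: mult_eq_conv[OF B] sandwich_def conv_assoc)
  also have "(?c \<otimes> (?b \<otimes> ?b)) \<cdot> (?b \<otimes> (?c \<otimes> ?b)) = symm C (obj B \<odot> obj B) (obj B) \<otimes> ?b"
    using B interchange'[of "?b \<otimes> ?c" "?c \<otimes> ?b" ?b ?b] by (simp add: hexagon')
  also have "convolution C B (convolution C B ?b ?s) ?b \<cdot> \<dots> =
      convolution C B (convolution C B ?b ?s \<cdot> symm C (obj B \<odot> obj B) (obj B)) ?b"
    using B w conv_comp[of B "convolution C B ?b ?s" ?b "symm C (obj B \<odot> obj B) (obj B)" ?b] by simp
  finally show ?thesis
    using B w by (simp add: conv_op)
qed

text \<open>Contracting a product one factor at a time. If contracting \<open>q\<close> leaves the element \<open>u\<close> between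
  the outer letters, then \<open>p\<close> is contracted with \<open>u\<close> in place of \<open>w\<close>; what remains of \<open>q\<close> is \<open>e\<close> in
  the monoid \<open>A\<close>, which multiplies from the right and has to pass the contracted letter of \<open>p\<close>. Being a
  point, \<open>u\<close> can be moved to its place inside \<open>p\<close>.\<close>

lemma sandwich_conv_op_right:
  assumes A: "is_monoid C A" and B: "is_monoid C B"
    and w: "w \<in> mor C" "dom C w = \<K>" "cod C w = obj B"
    and u: "u \<in> mor C" "dom C u = \<K>" "cod C u = obj B"
    and p: "p \<in> mor C" "cod C p = obj A \<odot> (obj B \<odot> obj B)"
    and q: "q \<in> mor C" "cod C q = obj A \<odot> (obj B \<odot> obj B)"
    and e: "e \<in> mor C" "cod C e = obj A"
    and eq: "(\<one> (obj A) \<otimes> sandwich B w) \<cdot> q = e \<otimes> u"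
  shows "(\<one> (obj A) \<otimes> sandwich B w) \<cdot>
      convolution C (tensor_monoid C A (tensor_monoid C B (op_monoid B))) p q =
    (\<mu> A \<otimes> \<one> (obj B)) \<cdot> ((\<one> (obj A) \<otimes> symm C (obj B) (obj A)) \<cdot>
      (((\<one> (obj A) \<otimes> sandwich B u) \<cdot> p) \<otimes> e))"
proof -
  let ?a = "\<one> (obj A)" and ?b = "\<one> (obj B)" and ?c = "symm C (obj B \<odot> obj B) (obj A)"
  let ?T = "tensor_monoid C B (op_monoid B)"
  (* On elements: y \<otimes> z \<otimes> x is sent to y x z. *)
  define Z where "Z = convolution C B ?b (convolution C (op_monoid B) ?b ?b)"
  have Z [simp]: "Z \<in> mor C" "dom C Z = obj B \<odot> (obj B \<odot> obj B)" "cod C Z = obj B"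
    using B by (simp_all add: Z_def)
  have sT: "sandwich B w \<cdot> \<mu> ?T = Z \<cdot> (?b \<otimes> (?b \<otimes> sandwich B w))"
    using B w by (simp add: sandwich_op_right Z_def conv_comp)
  have Zu: "Z \<cdot> (?b \<otimes> (?b \<otimes> u)) = sandwich B u"
  proof -
    have "convolution C (op_monoid B) ?b u = convolution C B u ?b"
      using B u by (simp add: conv_op symm_unit_right)
    then show ?thesis
      using B u by (simp add: Z_def conv_comp sandwich_def)
  qed
  have "(?a \<otimes> sandwich B w) \<cdot> convolution C (tensor_monoid C A ?T) p q =
      ((?a \<otimes> sandwich B w) \<cdot> (\<mu> A \<otimes> \<mu> ?T)) \<cdot> ((?a \<otimes> (?c \<otimes> (?b \<otimes> ?b))) \<cdot> (p \<otimes> q))"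
    using A B w p q by (simp add: convolution_def tensor_mult[of A ?T])
  also have "(?a \<otimes> sandwich B w) \<cdot> (\<mu> A \<otimes> \<mu> ?T) = \<mu> A \<otimes> (Z \<cdot> (?b \<otimes> (?b \<otimes> sandwich B w)))"
    using A B w by (simp add: interchange' sT)
  also have "\<dots> = (\<mu> A \<otimes> Z) \<cdot> ((?a \<otimes> ?a) \<otimes> (?b \<otimes> (?b \<otimes> sandwich B w)))"
    using A B w interchange'[of "?a \<otimes> ?a" "\<mu> A" "?b \<otimes> (?b \<otimes> sandwich B w)" Z] by simp
  also have "\<dots> \<cdot> ((?a \<otimes> (?c \<otimes> (?b \<otimes> ?b))) \<cdot> (p \<otimes> q)) =
      (\<mu> A \<otimes> Z) \<cdot> ((((?a \<otimes> ?a) \<otimes> (?b \<otimes> (?b \<otimes> sandwich B w))) \<cdot> (?a \<otimes> (?c \<otimes> (?b \<otimes> ?b)))) \<cdot> (p \<otimes> q))"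
    using A B w p q by simp
  also have "((?a \<otimes> ?a) \<otimes> (?b \<otimes> (?b \<otimes> sandwich B w))) \<cdot> (?a \<otimes> (?c \<otimes> (?b \<otimes> ?b))) = 
     (?a \<otimes> (?c \<otimes> ?b)) \<cdot> ((?a \<otimes> (?b \<otimes> ?b)) \<otimes> (?a \<otimes> sandwich B w))"
    using A B w interchange'[of "?b \<otimes> (?b \<otimes> ?a)" ?c "sandwich B w" ?b]
      interchange'[of ?c "?a \<otimes> (?b \<otimes> ?b)" "?b \<otimes> ?b" "sandwich B w"]
    by (simp add: interchange')
  also have "\<dots> \<cdot> (p \<otimes> q) = (?a \<otimes> (?c \<otimes> ?b)) \<cdot> (p \<otimes> (e \<otimes> u))"
    using A B w p q eq interchange'[of p "?a \<otimes> (?b \<otimes> ?b)" q "?a \<otimes> sandwich B w"] by simp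
  also have "p \<otimes> (e \<otimes> u) = ((?a \<otimes> (?b \<otimes> ?b)) \<otimes> (?a \<otimes> u)) \<cdot> (p \<otimes> e)"
    using A B u p e interchange'[of p "?a \<otimes> (?b \<otimes> ?b)" e "?a \<otimes> u"] by (simp add: point_right)
  also have "(\<mu> A \<otimes> Z) \<cdot> ((?a \<otimes> (?c \<otimes> ?b)) \<cdot> (((?a \<otimes> (?b \<otimes> ?b)) \<otimes> (?a \<otimes> u)) \<cdot> (p \<otimes> e))) =
     (\<mu> A \<otimes> Z) \<cdot> (((?a \<otimes> (?c \<otimes> ?b)) \<cdot> ((?a \<otimes> (?b \<otimes> ?b)) \<otimes> (?a \<otimes> u))) \<cdot> (p \<otimes> e))"
    using A B w u p e by simp
  also have "(?a \<otimes> (?c \<otimes> ?b)) \<cdot> ((?a \<otimes> (?b \<otimes> ?b)) \<otimes> (?a \<otimes> u)) =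
      ((?a \<otimes> ?a) \<otimes> (?b \<otimes> (?b \<otimes> u))) \<cdot> (?a \<otimes> ?c)"
    using A B u interchange'[of "?b \<otimes> (?b \<otimes> ?a)" ?c u ?b] point_right[of "?a \<otimes> (?b \<otimes> ?b)" u ?c]
    by (simp add: interchange')
  also have "(\<mu> A \<otimes> Z) \<cdot> ((((?a \<otimes> ?a) \<otimes> (?b \<otimes> (?b \<otimes> u))) \<cdot> (?a \<otimes> ?c)) \<cdot> (p \<otimes> e)) =
      ((\<mu> A \<otimes> Z) \<cdot> ((?a \<otimes> ?a) \<otimes> (?b \<otimes> (?b \<otimes> u)))) \<cdot> ((?a \<otimes> ?c) \<cdot> (p \<otimes> e))"
    using A B w u p e by simp
  also have "(\<mu> A \<otimes> Z) \<cdot> ((?a \<otimes> ?a) \<otimes> (?b \<otimes> (?b \<otimes> u))) = (\<mu> A \<otimes> ?b) \<cdot> (?a \<otimes> (?a \<otimes> sandwich B u))"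
    using A B u interchange'[of "?a \<otimes> ?a" "\<mu> A" "?b \<otimes> (?b \<otimes> u)" Z] 
      interchange'[of "?a \<otimes> ?a" "\<mu> A" "sandwich B u" ?b] by (simp add: Zu)
  also have "\<dots> \<cdot> ((?a \<otimes> ?c) \<cdot> (p \<otimes> e)) = (\<mu> A \<otimes> ?b) \<cdot> (((?a \<otimes> (?a \<otimes> sandwich B u)) \<cdot> (?a \<otimes> ?c)) \<cdot> (p \<otimes> e))"
    using A B w u p e by simp
  also have "(?a \<otimes> (?a \<otimes> sandwich B u)) \<cdot> (?a \<otimes> ?c) = (?a \<otimes> symm C (obj B) (obj A)) \<cdot> (?a \<otimes> (sandwich B u \<otimes> ?a))"
    using A B u symm_natural'[of "sandwich B u" ?a "obj B" "obj A"] by (simp add: interchange')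
  also have "\<dots> \<cdot> (p \<otimes> e) = (?a \<otimes> symm C (obj B) (obj A)) \<cdot> (((?a \<otimes> sandwich B u) \<cdot> p) \<otimes> e)"
    using A B u p e interchange'[of p "?a \<otimes> sandwich B u" e ?a] by simp
  finally show ?thesis .
qed

text \<open>The mirror image of \<open>sandwich_conv_op_right\<close>, with the first factor contracted first.\<close>

lemma sandwich_conv_op_left:
  assumes A: "is_monoid C A" and B: "is_monoid C B"
    and w: "w \<in> mor C" "dom C w = \<K>" "cod C w = obj B"
    and u: "u \<in> mor C" "dom C u = \<K>" "cod C u = obj B"
    and p: "p \<in> mor C" "cod C p = obj A \<odot> (obj B \<odot> obj B)"
    and q: "q \<in> mor C" "cod C q = obj A \<odot> (obj B \<odot> obj B)"
    and e: "e \<in> mor C" "cod C e = obj A"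
    and eq: "(\<one> (obj A) \<otimes> sandwich B w) \<cdot> p = e \<otimes> u"
  shows "(\<one> (obj A) \<otimes> sandwich B w) \<cdot>
      convolution C (tensor_monoid C A (tensor_monoid C (op_monoid B) B)) p q =
    (\<mu> A \<otimes> \<one> (obj B)) \<cdot> (e \<otimes> ((\<one> (obj A) \<otimes> sandwich B u) \<cdot> q))"
proof -
  let ?a = "\<one> (obj A)" and ?b = "\<one> (obj B)" and ?c = "symm C (obj B \<odot> obj B) (obj A)"
    and ?d = "symm C (obj B) (obj A)"
  let ?T = "tensor_monoid C (op_monoid B) B"
  (* On elements: x \<otimes> y \<otimes> z is sent to y x z. *)
  define Z where "Z = convolution C B (convolution C (op_monoid B) ?b ?b) ?b"
  have Z [simp]: "Z \<in> mor C" "dom C Z = obj B \<odot> (obj B \<odot> obj B)" "cod C Z = obj B"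
    using B by (simp_all add: Z_def)
  have Z_comp: "Z \<cdot> (x \<otimes> (y \<otimes> ?b)) = convolution C B (convolution C (op_monoid B) x y) ?b"
    if "x \<in> mor C" "y \<in> mor C" "cod C x = obj B" "cod C y = obj B" for x y
  proof -
    have "Z \<cdot> ((x \<otimes> y) \<otimes> ?b) = convolution C B (convolution C (op_monoid B) ?b ?b \<cdot> (x \<otimes> y)) (?b \<cdot> ?b)"
      unfolding Z_def using B that by (intro conv_comp) simp_all
    then show ?thesis
      using B that by (simp add: conv_comp)
  qed
  have sT: "sandwich B w \<cdot> \<mu> ?T = Z \<cdot> (sandwich B w \<otimes> (?b \<otimes> ?b))"
    using B w Z_comp[of "sandwich B w" ?b] by (simp add: sandwich_op_left)
  have Zu: "Z \<cdot> (u \<otimes> (?b \<otimes> ?b)) = sandwich B u"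
  proof -
    have "convolution C (op_monoid B) u ?b = convolution C B ?b u"
      using B u by (simp add: conv_op symm_unit_left)
    then show ?thesis
      using B u Z_comp[of u ?b] by (simp add: sandwich_def conv_assoc)
  qed
  have "(?d \<otimes> (?b \<otimes> ?b)) \<cdot> (u \<otimes> q) = (?d \<otimes> (?b \<otimes> ?b)) \<cdot> ((u \<otimes> (?a \<otimes> (?b \<otimes> ?b))) \<cdot> q)"
    using A B u q by (simp add: point_left)
  also have "\<dots> = ((?d \<otimes> (?b \<otimes> ?b)) \<cdot> ((u \<otimes> ?a) \<otimes> (?b \<otimes> ?b))) \<cdot> q"
    using A B u q by simp
  also have "(?d \<otimes> (?b \<otimes> ?b)) \<cdot> ((u \<otimes> ?a) \<otimes> (?b \<otimes> ?b)) = (?d \<cdot> (u \<otimes> ?a)) \<otimes> (?b \<otimes> ?b)"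
    using A B u interchange'[of "u \<otimes> ?a" ?d "?b \<otimes> ?b" "?b \<otimes> ?b"] by simp
  finally have du: "(?d \<otimes> (?b \<otimes> ?b)) \<cdot> (u \<otimes> q) = ((?d \<cdot> (u \<otimes> ?a)) \<otimes> (?b \<otimes> ?b)) \<cdot> q" .
  have "(?a \<otimes> sandwich B w) \<cdot> convolution C (tensor_monoid C A ?T) p q =
      ((?a \<otimes> sandwich B w) \<cdot> (\<mu> A \<otimes> \<mu> ?T)) \<cdot> ((?a \<otimes> (?c \<otimes> (?b \<otimes> ?b))) \<cdot> (p \<otimes> q))"
    using A B w p q by (simp add: convolution_def tensor_mult[of A ?T])
  also have "(?a \<otimes> sandwich B w) \<cdot> (\<mu> A \<otimes> \<mu> ?T) = \<mu> A \<otimes> (Z \<cdot> (sandwich B w \<otimes> (?b \<otimes> ?b)))"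
    using A B w by (simp add: interchange' sT)
  also have "\<dots> = (\<mu> A \<otimes> Z) \<cdot> ((?a \<otimes> ?a) \<otimes> (sandwich B w \<otimes> (?b \<otimes> ?b)))"
    using A B w interchange'[of "?a \<otimes> ?a" "\<mu> A" "sandwich B w \<otimes> (?b \<otimes> ?b)" Z] by simp
  also have "\<dots> \<cdot> ((?a \<otimes> (?c \<otimes> (?b \<otimes> ?b))) \<cdot> (p \<otimes> q)) =
      (\<mu> A \<otimes> Z) \<cdot> ((((?a \<otimes> ?a) \<otimes> (sandwich B w \<otimes> (?b \<otimes> ?b))) \<cdot> (?a \<otimes> (?c \<otimes> (?b \<otimes> ?b)))) \<cdot> (p \<otimes> q))"
    using A B w p q by simp
  also have "((?a \<otimes> ?a) \<otimes> (sandwich B w \<otimes> (?b \<otimes> ?b))) \<cdot> (?a \<otimes> (?c \<otimes> (?b \<otimes> ?b))) = 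
     (?a \<otimes> (?d \<otimes> (?b \<otimes> ?b))) \<cdot> ((?a \<otimes> sandwich B w) \<otimes> (?a \<otimes> (?b \<otimes> ?b)))"
    using A B w interchange'[of ?c "?a \<otimes> sandwich B w" "?b \<otimes> ?b" "?b \<otimes> ?b"]
      interchange'[of "sandwich B w \<otimes> ?a" ?d "?b \<otimes> ?b" "?b \<otimes> ?b"]
      symm_natural'[of "sandwich B w" ?a "obj B" "obj A"]
    by (simp add: interchange')
  also have "\<dots> \<cdot> (p \<otimes> q) = (?a \<otimes> (?d \<otimes> (?b \<otimes> ?b))) \<cdot> ((e \<otimes> u) \<otimes> q)"
    using A B w p q eq interchange'[of p "?a \<otimes> sandwich B w" q "?a \<otimes> (?b \<otimes> ?b)"] by simp
  also have "\<dots> = (?a \<otimes> ((?d \<cdot> (u \<otimes> ?a)) \<otimes> (?b \<otimes> ?b))) \<cdot> (e \<otimes> q)"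
    using A B u e q by (simp add: interchange' du)
  also have "?d \<cdot> (u \<otimes> ?a) = ?a \<otimes> u"
    using A B u by (simp add: symm_point_left)
  also have "(\<mu> A \<otimes> Z) \<cdot> ((?a \<otimes> ((?a \<otimes> u) \<otimes> (?b \<otimes> ?b))) \<cdot> (e \<otimes> q)) =
     ((\<mu> A \<otimes> Z) \<cdot> ((?a \<otimes> ?a) \<otimes> (u \<otimes> (?b \<otimes> ?b)))) \<cdot> (e \<otimes> q)"
    using A B u e q by simp
  also have "(\<mu> A \<otimes> Z) \<cdot> ((?a \<otimes> ?a) \<otimes> (u \<otimes> (?b \<otimes> ?b))) = (\<mu> A \<otimes> ?b) \<cdot> (?a \<otimes> (?a \<otimes> sandwich B u))"
    using A B u interchange'[of "?a \<otimes> ?a" "\<mu> A" "u \<otimes> (?b \<otimes> ?b)" Z] 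
      interchange'[of "?a \<otimes> ?a" "\<mu> A" "sandwich B u" ?b] by (simp add: Zu)
  also have "\<dots> \<cdot> (e \<otimes> q) = (\<mu> A \<otimes> ?b) \<cdot> (e \<otimes> ((?a \<otimes> sandwich B u) \<cdot> q))"
    using A B u e q by (simp add: interchange')
  finally show ?thesis .
qed

text \<open>The codomain of the counit, so that the counit axioms say that the counit is a morphism of
  monoids.\<close>

definition unit_monoid :: "('o, 'm) monoid_data" where
  "unit_monoid = \<lparr> obj = \<K>, eta = \<one> \<K>, mult = \<one> \<K> \<rparr>"

lemma unit_monoid_simps [simp]: "obj unit_monoid = \<K>" "\<eta> unit_monoid = \<one> \<K>" "\<mu> unit_monoid = \<one> \<K>"
  by (simp_all add: unit_monoid_def)

lemma unit_is_monoid [simp]: "is_monoid C unit_monoid"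
  by (simp add: is_monoid_def hom_iff)

lemma unit_tensor_mult: "is_monoid C A \<Longrightarrow> \<mu> (tensor_monoid C unit_monoid A) = \<mu> A"
  and tensor_unit_mult: "is_monoid C A \<Longrightarrow> \<mu> (tensor_monoid C A unit_monoid) = \<mu> A"
  by (simp_all add: tensor_mult symm_unit_left symm_unit_right)

end

section \<open>The antipode is antimultiplicative\<close>

locale right_Hopf_coquasigroup_data = strict_symmetric_monoidal_category C
  for C :: "('o, 'm) smcat" (structure) +
  fixes H :: "('o, 'm) bimonoid_data" and \<rho> :: 'm
  assumes bimonoid: "noncoassociative_bimonoid C H" and antipode: "right_antipode C H \<rho>"
begin

abbreviation "X \<equiv> obj H"
abbreviation "i \<equiv> \<one> (obj H)"
abbreviation "m \<equiv> \<mu> H"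
abbreviation "n \<equiv> \<eta> H"
abbreviation "e \<equiv> \<epsilon> H"
abbreviation "d \<equiv> \<delta> H"
abbreviation "HH \<equiv> tensor_monoid C H H"
abbreviation "HHH \<equiv> tensor_monoid C H (tensor_monoid C H H)"

lemma H_monoid [simp]: "is_monoid C H"
  using bimonoid by (simp add: noncoassociative_bimonoid_def)

lemma H_typing [simp]:
  "e \<in> mor C" "dom C e = X" "cod C e = \<K>" "d \<in> mor C" "dom C d = X" "cod C d = X \<odot> X"
  "\<rho> \<in> mor C" "dom C \<rho> = X" "cod C \<rho> = X"
  using bimonoid antipode
  by (simp_all add: noncoassociative_bimonoid_def counital_comagma_def right_antipode_def hom_iff)

lemma counit_comult [simp]: "(e \<otimes> i) \<cdot> d = i" "(i \<otimes> e) \<cdot> d = i"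
  using bimonoid by (simp_all add: noncoassociative_bimonoid_def counital_comagma_def)

lemma comult_hom: "monoid_hom H HH d" and counit_hom: "monoid_hom H unit_monoid e"
  using bimonoid by (simp_all add: noncoassociative_bimonoid_def monoid_hom_def hom_iff)

lemma counit_unit [simp]: "e \<cdot> n = \<one> \<K>" and comult_unit [simp]: "d \<cdot> n = n \<otimes> n"
  using monoid_homD(4)[OF counit_hom] monoid_homD(4)[OF comult_hom] by simp_all

text \<open>Counits on one tensor factor preserve products, once the factor \<open>\<K>\<close> is left out.\<close>

lemma counit_tens_hom: assumes B: "is_monoid C B"
  shows "monoid_hom (tensor_monoid C H B) B (e \<otimes> \<one> (obj B))"
    and "monoid_hom (tensor_monoid C B H) B (\<one> (obj B) \<otimes> e)"
  using B tensor_monoid_hom[OF H_monoid B unit_is_monoid B counit_hom id_monoid_hom[OF B]]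
    tensor_monoid_hom[OF B H_monoid B unit_is_monoid id_monoid_hom[OF B] counit_hom]
  by (simp_all add: monoid_hom_def unit_tensor_mult tensor_unit_mult hom_iff)

definition "comult_twice = (d \<otimes> i) \<cdot> d"

lemma comult_twice_typing [simp]: "comult_twice \<in> mor C" "dom C comult_twice = X" "cod C comult_twice = X \<odot> (X \<odot> X)"
  by (simp_all add: comult_twice_def)

lemma antipode_last: "(i \<otimes> m) \<cdot> ((i \<otimes> (i \<otimes> \<rho>)) \<cdot> comult_twice) = i \<otimes> n"
proof -
  have "(i \<otimes> (i \<otimes> \<rho>)) \<cdot> comult_twice = (d \<otimes> \<rho>) \<cdot> d"
    unfolding comult_twice_def using interchange'[of d "i \<otimes> i" i \<rho>] 
      comp_assoc'[of d "d \<otimes> i" "i \<otimes> (i \<otimes> \<rho>)"] by simp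
  then show ?thesis
    using antipode by (simp add: right_antipode_def)
qed

lemma antipode_mid: "(i \<otimes> m) \<cdot> ((i \<otimes> (\<rho> \<otimes> i)) \<cdot> comult_twice) = i \<otimes> n"
proof -
  have "(i \<otimes> (\<rho> \<otimes> i)) \<cdot> comult_twice = (((i \<otimes> \<rho>) \<cdot> d) \<otimes> i) \<cdot> d"
    unfolding comult_twice_def using interchange'[of d "i \<otimes> \<rho>" i i] 
      comp_assoc'[of d "d \<otimes> i" "i \<otimes> (\<rho> \<otimes> i)"] by simp
  then show ?thesis
    using antipode by (simp add: right_antipode_def)
qed

text \<open>The familiar form of the antipode laws, by applying the counit to the first factor.\<close>

lemma antipode_counit: "m \<cdot> ((i \<otimes> \<rho>) \<cdot> d) = n \<cdot> e" "m \<cdot> ((\<rho> \<otimes> i) \<cdot> d) = n \<cdot> e"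
proof -
  (* Both antipode laws have this shape, with f the antipode on one of the two factors. *)
  have *: "m \<cdot> (f \<cdot> d) = n \<cdot> e"
    if f: "f \<in> mor C" "dom C f = X \<odot> X" "cod C f = X \<odot> X" and eq: "(i \<otimes> m) \<cdot> ((i \<otimes> f) \<cdot> comult_twice) = i \<otimes> n" for f
  proof -
    have "n \<cdot> e = (e \<otimes> i) \<cdot> (i \<otimes> n)"
      using interchange'[of i e n i] point_right[of "\<one> \<K>" n e] interchange'[of "\<one> \<K>" n e "\<one> \<K>"] by simp
    also have "\<dots> = (((e \<otimes> i) \<cdot> (i \<otimes> m)) \<cdot> (i \<otimes> f)) \<cdot> comult_twice"
      unfolding eq[symmetric] using f by simp
    also have "((e \<otimes> i) \<cdot> (i \<otimes> m)) \<cdot> (i \<otimes> f) = e \<otimes> (m \<cdot> f)"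
      using f by (simp add: interchange')
    also have "\<dots> \<cdot> comult_twice = ((e \<otimes> (m \<cdot> f)) \<cdot> (d \<otimes> i)) \<cdot> d"
      unfolding comult_twice_def using f by simp
    also have "(e \<otimes> (m \<cdot> f)) \<cdot> (d \<otimes> i) = (m \<cdot> f) \<cdot> (((e \<otimes> i) \<cdot> d) \<otimes> i)"
    proof -
      have "e \<otimes> (m \<cdot> f) = (m \<cdot> f) \<cdot> (e \<otimes> (i \<otimes> i))"
        using f interchange'[of e "\<one> \<K>" "i \<otimes> i" "m \<cdot> f"] by simp
      then show ?thesis 
        using f interchange'[of d "e \<otimes> i" i i] by simp
    qed
    finally show ?thesis using f by simp
  qed
  show "m \<cdot> ((i \<otimes> \<rho>) \<cdot> d) = n \<cdot> e" "m \<cdot> ((\<rho> \<otimes> i) \<cdot> d) = n \<cdot> e"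
    using *[of "i \<otimes> \<rho>"] *[of "\<rho> \<otimes> i"] antipode_last antipode_mid by simp_all
qed

lemma antipode_unit: "\<rho> \<cdot> n = n"
proof -
  have "n = (m \<cdot> ((i \<otimes> \<rho>) \<cdot> d)) \<cdot> n"
    unfolding antipode_counit by simp
  also have "\<dots> = convolution C H n (\<rho> \<cdot> n)"
    by (simp add: interchange' convolution_def)
  finally show ?thesis by simp
qed

text \<open>The map \<open>h \<otimes> k \<mapsto> h1 \<otimes> \<rho>(h2) k\<close> is a left inverse of \<open>h \<otimes> k \<mapsto> h1 \<otimes> h2 k\<close>: the composite is
  \<open>h11 \<otimes> \<rho>(h12) h2 k\<close>.\<close>

lemma insert_cancel:
  assumes x: "x \<in> mor C" "cod C x = X \<odot> X"
  shows "(i \<otimes> m) \<cdot> ((((i \<otimes> \<rho>) \<cdot> d) \<otimes> i) \<cdot> ((i \<otimes> m) \<cdot> ((d \<otimes> i) \<cdot> x))) = x"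
proof -
  let ?r = "(i \<otimes> \<rho>) \<cdot> d" and ?q = "i \<otimes> (\<rho> \<otimes> i)"
  have ass: "m \<cdot> (i \<otimes> m) = m \<cdot> (m \<otimes> i)"
    using H_monoid unfolding is_monoid_def by simp
  have 1: "(?r \<otimes> i) \<cdot> (i \<otimes> m) = (i \<otimes> (i \<otimes> m)) \<cdot> (?r \<otimes> (i \<otimes> i))"
    by (simp add: interchange' fuse_left)
  have 2: "(?r \<otimes> (i \<otimes> i)) \<cdot> (d \<otimes> i) = (?q \<cdot> comult_twice) \<otimes> i"
    using interchange'[of d "?r \<otimes> i" i i] interchange'[of d "i \<otimes> \<rho>" i i]
      comp_reassoc[of d "d \<otimes> i" ?q "?r \<otimes> i"] by (simp add: comult_twice_def)
  have "(i \<otimes> m) \<cdot> ((?r \<otimes> i) \<cdot> ((i \<otimes> m) \<cdot> ((d \<otimes> i) \<cdot> x))) =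
      (i \<otimes> m) \<cdot> (((?r \<otimes> i) \<cdot> (i \<otimes> m)) \<cdot> ((d \<otimes> i) \<cdot> x))"
    using x by (simp del: counit_comult)
  also have "\<dots> = ((i \<otimes> m) \<cdot> (i \<otimes> (i \<otimes> m))) \<cdot> (((?r \<otimes> (i \<otimes> i)) \<cdot> (d \<otimes> i)) \<cdot> x)"
    unfolding 1 using x by simp
  also have "(i \<otimes> m) \<cdot> (i \<otimes> (i \<otimes> m)) = (i \<otimes> m) \<cdot> ((i \<otimes> m) \<otimes> i)"
    using interchange'[of i i "i \<otimes> m" m] interchange'[of i i "m \<otimes> i" m] ass by simp
  also have "\<dots> \<cdot> (((?r \<otimes> (i \<otimes> i)) \<cdot> (d \<otimes> i)) \<cdot> x) = (i \<otimes> m) \<cdot> ((((i \<otimes> m) \<otimes> i) \<cdot> ((?q \<cdot> comult_twice) \<otimes> i)) \<cdot> x)"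
    unfolding 2 using x by simp
  also have "((i \<otimes> m) \<otimes> i) \<cdot> ((?q \<cdot> comult_twice) \<otimes> i) = (i \<otimes> n) \<otimes> i"
    using interchange'[of "?q \<cdot> comult_twice" "i \<otimes> m" i i] antipode_mid by simp
  also have "(i \<otimes> m) \<cdot> (((i \<otimes> n) \<otimes> i) \<cdot> x) = ((i \<otimes> m) \<cdot> (i \<otimes> (n \<otimes> i))) \<cdot> x"
    using x by simp
  also have "(i \<otimes> m) \<cdot> (i \<otimes> (n \<otimes> i)) = i \<otimes> i"
    using interchange'[of i i "n \<otimes> i" m] conv_unit_left[of H i] by (simp add: convolution_def)
  finally show ?thesis using x by simp
qed

text \<open>With \<open>\<beta>(g \<otimes> h) = g1 h1 \<otimes> \<rho>(h2) \<rho>(g2)\<close>, the map \<open>h \<otimes> k \<mapsto> h1 \<otimes> h2 k\<close> sends \<open>\<beta>\<close> to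
  \<open>g11 h11 \<otimes> g12 h12 \<rho>(h2) \<rho>(g2) = g h \<otimes> 1\<close>, a nested contraction. Its left inverse
  (\<open>insert_cancel\<close>) sends \<open>g h \<otimes> 1\<close> to \<open>(g h)1 \<otimes> \<rho>((g h)2)\<close>, which is therefore \<open>\<beta>\<close>, and the
  counit on the first factor gives the claim.\<close>

lemma antipode_antimultiplicative: "\<rho> \<cdot> m = \<mu> (op_monoid H) \<cdot> (\<rho> \<otimes> \<rho>)"
proof -
  let ?O = "op_monoid H" and ?c = "symm C X X"
  let ?HO = "tensor_monoid C H ?O" 
  define r where "r = (i \<otimes> \<rho>) \<cdot> d"
  define \<beta> where "\<beta> = convolution C ?HO r r"
  have r [simp]: "r \<in> mor C" "dom C r = X" "cod C r = X \<odot> X"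
    by (simp_all add: r_def)
  have \<beta> [simp]: "\<beta> \<in> mor C" "dom C \<beta> = X \<odot> X" "cod C \<beta> = X \<odot> X"
    by (simp_all add: \<beta>_def)
  define p where "p = (d \<otimes> i) \<cdot> r"
  have p [simp]: "p \<in> mor C" "dom C p = X" "cod C p = X \<odot> (X \<odot> X)"
    by (simp_all add: p_def)
  have p_D: "p = (i \<otimes> (i \<otimes> \<rho>)) \<cdot> comult_twice"
  proof -
    have "(d \<otimes> i) \<cdot> (i \<otimes> \<rho>) = (i \<otimes> (i \<otimes> \<rho>)) \<cdot> (d \<otimes> i)"
      using interchange'[of d "i \<otimes> i" i \<rho>] by (simp add: interchange')
    then show ?thesis
      by (simp add: p_def r_def comult_twice_def flip: comp_assoc')
  qed
  have "monoid_hom ?HO (tensor_monoid C HH ?O) (d \<otimes> i)"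
    using tensor_monoid_hom[of H ?O HH ?O d i] comult_hom id_monoid_hom[of ?O] by simp
  then have "(d \<otimes> i) \<cdot> \<beta> = convolution C (tensor_monoid C HH ?O) p p"
    by (simp add: \<beta>_def p_def hom_conv)
  then have d\<beta>: "(d \<otimes> i) \<cdot> \<beta> = convolution C (tensor_monoid C H ?HO) p p"
    by (simp add: tensor_monoid_assoc)
  have mp: "(i \<otimes> sandwich H n) \<cdot> p = i \<otimes> n"
    using antipode_last by (simp add: sandwich_unit p_D)
  have "(i \<otimes> m) \<cdot> ((d \<otimes> i) \<cdot> \<beta>) = (m \<otimes> i) \<cdot> ((i \<otimes> ?c) \<cdot> ((i \<otimes> n) \<otimes> i))"
    using sandwich_conv_op_right[of H H n n p p i] mp by (simp add: d\<beta> sandwich_unit)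
  also have "\<dots> = m \<otimes> n"
    by (simp add: interchange' symm_point_left fuse_right)
  finally have "(i \<otimes> m) \<cdot> ((r \<otimes> i) \<cdot> (m \<otimes> n)) = \<beta>"
    using insert_cancel[of \<beta>] by (simp add: r_def)
  moreover have "(i \<otimes> m) \<cdot> ((r \<otimes> i) \<cdot> (m \<otimes> n)) = r \<cdot> m"
  proof -
    have "(r \<otimes> i) \<cdot> (m \<otimes> n) = (i \<otimes> (i \<otimes> n)) \<cdot> (r \<cdot> m)"
      using point_right[of "i \<otimes> i" n "r \<cdot> m"] by (simp add: interchange')
    moreover have "(i \<otimes> m) \<cdot> (i \<otimes> (i \<otimes> n)) = i \<otimes> i"
      using interchange'[of i i "i \<otimes> n" m] conv_unit_right[of H i] by (simp add: convolution_def)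
    ultimately show ?thesis
      using comp_assoc'[of "r \<cdot> m" "i \<otimes> (i \<otimes> n)" "i \<otimes> m"] by simp
  qed
  ultimately have "\<beta> = r \<cdot> m" by simp
  moreover have er: "(e \<otimes> i) \<cdot> r = \<rho>"
  proof -
    have "(e \<otimes> i) \<cdot> (i \<otimes> \<rho>) = \<rho> \<cdot> (e \<otimes> i)"
      using interchange'[of e "\<one> \<K>" i \<rho>] by (simp add: interchange')
    then show ?thesis
      using comp_reassoc[of d "i \<otimes> \<rho>" "e \<otimes> i" "\<rho> \<cdot> (e \<otimes> i)"] by (simp add: r_def)
  qed
  moreover have "(e \<otimes> i) \<cdot> \<beta> = convolution C ?O ((e \<otimes> i) \<cdot> r) ((e \<otimes> i) \<cdot> r)"
    unfolding \<beta>_def using counit_tens_hom(1)[of ?O] by (simp add: hom_conv)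
  ultimately show ?thesis
    using comp_assoc'[of m r "e \<otimes> i"] by (simp add: convolution_def)
qed

lemma antipode_hom: "monoid_hom H (op_monoid H) \<rho>"
  using antipode_antimultiplicative antipode_unit by (simp add: monoid_hom_def hom_iff)

section \<open>Contractions with the antipode\<close>

text \<open>On elements, \<open>x \<otimes> y \<otimes> z \<mapsto> x \<otimes> y w \<rho>(z)\<close>; the second antipode contraction below is
  \<open>x \<otimes> y \<otimes> z \<mapsto> x \<otimes> \<rho>(y) w z\<close>.\<close>

definition contract_last :: "'m \<Rightarrow> 'm \<Rightarrow> 'm" where
  "contract_last w x = (i \<otimes> sandwich H w) \<cdot> ((i \<otimes> (i \<otimes> \<rho>)) \<cdot> x)"

definition contract_mid :: "'m \<Rightarrow> 'm \<Rightarrow> 'm" where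
  "contract_mid w x = (i \<otimes> sandwich H w) \<cdot> ((i \<otimes> (\<rho> \<otimes> i)) \<cdot> x)"

lemma contract_typing [simp]:
  assumes "w \<in> mor C" "dom C w = \<K>" "cod C w = X" "x \<in> mor C" "cod C x = X \<odot> (X \<odot> X)"
  shows "contract_last w x \<in> mor C" "dom C (contract_last w x) = dom C x"
    "cod C (contract_last w x) = X \<odot> X"
    "contract_mid w x \<in> mor C" "dom C (contract_mid w x) = dom C x"
    "cod C (contract_mid w x) = X \<odot> X"
  using assms by (simp_all add: contract_last_def contract_mid_def)

text \<open>Applying the antipode to a factor turns its multiplication into the opposite one, so the
  nested contraction of products applies.\<close>

lemma contract_last_conv:
  assumes w: "w \<in> mor C" "dom C w = \<K>" "cod C w = X" and u: "u \<in> mor C" "dom C u = \<K>" "cod C u = X"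
    and p: "p \<in> mor C" "cod C p = X \<odot> (X \<odot> X)" and q: "q \<in> mor C" "cod C q = X \<odot> (X \<odot> X)"
    and f: "f \<in> mor C" "cod C f = X" and eq: "contract_last w q = f \<otimes> u"
  shows "contract_last w (convolution C HHH p q) =
    (m \<otimes> i) \<cdot> ((i \<otimes> symm C X X) \<cdot> (contract_last u p \<otimes> f))"
proof -
  have "monoid_hom HHH (tensor_monoid C H (tensor_monoid C H (op_monoid H))) (i \<otimes> (i \<otimes> \<rho>))"
    using antipode_hom id_monoid_hom[of H] by (simp add: tensor_monoid_hom)
  then have "contract_last w (convolution C HHH p q) = (i \<otimes> sandwich H w) \<cdot>
      convolution C (tensor_monoid C H (tensor_monoid C H (op_monoid H)))
        ((i \<otimes> (i \<otimes> \<rho>)) \<cdot> p) ((i \<otimes> (i \<otimes> \<rho>)) \<cdot> q)"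
    using p q by (simp add: contract_last_def hom_conv)
  also have "\<dots> = (m \<otimes> i) \<cdot> ((i \<otimes> symm C X X) \<cdot> (contract_last u p \<otimes> f))"
    unfolding contract_last_def using w u p q f eq
    by (intro sandwich_conv_op_right) (simp_all add: contract_last_def)
  finally show ?thesis .
qed

lemma contract_mid_conv:
  assumes w: "w \<in> mor C" "dom C w = \<K>" "cod C w = X" and u: "u \<in> mor C" "dom C u = \<K>" "cod C u = X"
    and p: "p \<in> mor C" "cod C p = X \<odot> (X \<odot> X)" and q: "q \<in> mor C" "cod C q = X \<odot> (X \<odot> X)"
    and f: "f \<in> mor C" "cod C f = X" and eq: "contract_mid w p = f \<otimes> u"
  shows "contract_mid w (convolution C HHH p q) = (m \<otimes> i) \<cdot> (f \<otimes> contract_mid u q)"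
proof -
  have "monoid_hom HHH (tensor_monoid C H (tensor_monoid C (op_monoid H) H)) (i \<otimes> (\<rho> \<otimes> i))"
    using antipode_hom id_monoid_hom[of H] by (simp add: tensor_monoid_hom)
  then have "contract_mid w (convolution C HHH p q) = (i \<otimes> sandwich H w) \<cdot>
      convolution C (tensor_monoid C H (tensor_monoid C (op_monoid H) H))
        ((i \<otimes> (\<rho> \<otimes> i)) \<cdot> p) ((i \<otimes> (\<rho> \<otimes> i)) \<cdot> q)"
    using p q by (simp add: contract_mid_def hom_conv)
  also have "\<dots> = (m \<otimes> i) \<cdot> (f \<otimes> contract_mid u q)"
    unfolding contract_mid_def using w u p q f eq
    by (intro sandwich_conv_op_left) (simp_all add: contract_mid_def)
  finally show ?thesis .
qed

lemma unit_cancel: 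
  assumes "z \<in> mor C" "cod C z = X \<odot> Y" "Y \<in> ob C"
  shows "(m \<otimes> \<one> Y) \<cdot> (n \<otimes> z) = z" and "(m \<otimes> \<one> Y) \<cdot> ((i \<otimes> symm C Y X) \<cdot> (z \<otimes> n)) = z"
proof -
  have 1: "n \<otimes> z = (n \<otimes> (i \<otimes> \<one> Y)) \<cdot> z"
    using assms by (simp add: point_left)
  have 2: "m \<cdot> (n \<otimes> i) = i" "m \<cdot> (i \<otimes> n) = i"
    using H_monoid unfolding is_monoid_def by simp_all
  show "(m \<otimes> \<one> Y) \<cdot> (n \<otimes> z) = z"
    unfolding 1 using assms 2 interchange'[of "n \<otimes> i" m "\<one> Y" "\<one> Y"]
      comp_reassoc[of z "n \<otimes> (i \<otimes> \<one> Y)" "m \<otimes> \<one> Y" "i \<otimes> \<one> Y"] by simp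
  have "(i \<otimes> symm C Y X) \<cdot> (z \<otimes> n) = (i \<otimes> symm C Y X) \<cdot> ((i \<otimes> (\<one> Y \<otimes> n)) \<cdot> z)"
    using assms point_right[of "i \<otimes> \<one> Y" n z] by simp
  also have "\<dots> = ((i \<otimes> symm C Y X) \<cdot> (i \<otimes> (\<one> Y \<otimes> n))) \<cdot> z"
    using assms by simp
  also have "(i \<otimes> symm C Y X) \<cdot> (i \<otimes> (\<one> Y \<otimes> n)) = i \<otimes> (n \<otimes> \<one> Y)"
    using assms by (simp add: interchange' symm_point_right)
  finally show "(m \<otimes> \<one> Y) \<cdot> ((i \<otimes> symm C Y X) \<cdot> (z \<otimes> n)) = z"
    using assms 2 interchange'[of "i \<otimes> n" m "\<one> Y" "\<one> Y"]
      comp_reassoc[of z "i \<otimes> (n \<otimes> \<one> Y)" "m \<otimes> \<one> Y" "i \<otimes> \<one> Y"] by simp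
qed

lemma contract_last_comult_twice: "contract_last n comult_twice = i \<otimes> n"
  using antipode_last by (simp add: contract_last_def sandwich_unit)

lemma contract_mid_comult_twice: "contract_mid n comult_twice = i \<otimes> n"
  using antipode_mid by (simp add: contract_mid_def sandwich_unit)

lemma contract_point:
  assumes w: "w \<in> mor C" "dom C w = \<K>" "cod C w = X" and x: "x \<in> mor C" "cod C x = X \<odot> X"
  shows "contract_last w (n \<otimes> x) = n \<otimes> (sandwich H w \<cdot> ((i \<otimes> \<rho>) \<cdot> x))"
    "contract_mid w (n \<otimes> x) = n \<otimes> (sandwich H w \<cdot> ((\<rho> \<otimes> i) \<cdot> x))"
  using w x by (simp_all add: contract_last_def contract_mid_def interchange')

text \<open>If the last two letters come from one coproduct, both contractions reduce to the antipode law.\<close>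

lemma contract_tens_comult:
  assumes x: "x \<in> mor C" "cod C x = X \<odot> X"
  shows "contract_last n ((i \<otimes> d) \<cdot> x) = ((i \<otimes> e) \<cdot> x) \<otimes> n"
    "contract_mid n ((i \<otimes> d) \<cdot> x) = ((i \<otimes> e) \<cdot> x) \<otimes> n"
proof -
  have ne: "i \<otimes> (n \<cdot> e) = (i \<otimes> n) \<cdot> (i \<otimes> e)"
    by (simp add: interchange')
  have p: "((i \<otimes> n) \<cdot> (i \<otimes> e)) \<cdot> x = ((i \<otimes> e) \<cdot> x) \<otimes> n"
    using x point_right[of i n "(i \<otimes> e) \<cdot> x"] by simp
  have "contract_last n ((i \<otimes> d) \<cdot> x) = (i \<otimes> (m \<cdot> ((i \<otimes> \<rho>) \<cdot> d))) \<cdot> x"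
    using x comp_reassoc[of x "i \<otimes> d" "i \<otimes> (i \<otimes> \<rho>)" "i \<otimes> ((i \<otimes> \<rho>) \<cdot> d)"]
      comp_reassoc[of x "i \<otimes> ((i \<otimes> \<rho>) \<cdot> d)" "i \<otimes> m" "i \<otimes> (m \<cdot> ((i \<otimes> \<rho>) \<cdot> d))"]
      interchange'[of i i d "i \<otimes> \<rho>"] interchange'[of i i "(i \<otimes> \<rho>) \<cdot> d" m]
    by (simp add: contract_last_def sandwich_unit)
  then show "contract_last n ((i \<otimes> d) \<cdot> x) = ((i \<otimes> e) \<cdot> x) \<otimes> n"
    unfolding antipode_counit ne p .
  have "contract_mid n ((i \<otimes> d) \<cdot> x) = (i \<otimes> (m \<cdot> ((\<rho> \<otimes> i) \<cdot> d))) \<cdot> x"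
    using x comp_reassoc[of x "i \<otimes> d" "i \<otimes> (\<rho> \<otimes> i)" "i \<otimes> ((\<rho> \<otimes> i) \<cdot> d)"]
      comp_reassoc[of x "i \<otimes> ((\<rho> \<otimes> i) \<cdot> d)" "i \<otimes> m" "i \<otimes> (m \<cdot> ((\<rho> \<otimes> i) \<cdot> d))"]
      interchange'[of i i d "\<rho> \<otimes> i"] interchange'[of i i "(\<rho> \<otimes> i) \<cdot> d" m]
    by (simp add: contract_mid_def sandwich_unit)
  then show "contract_mid n ((i \<otimes> d) \<cdot> x) = ((i \<otimes> e) \<cdot> x) \<otimes> n"
    unfolding antipode_counit ne p .
qed

end

section \<open>The twist and the elements it gives\<close>

locale twisted_right_Hopf_coquasigroup = right_Hopf_coquasigroup_data C H \<rho>
  for C :: "('o, 'm) smcat" (structure) and H :: "('o, 'm) bimonoid_data" and \<rho> :: 'm +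
  fixes J J' :: 'm
  assumes twist: "twist C H J" and conormal: "conormal C H J"
    and inverse: "convolution_inverse C (tensor_monoid C H H) J J'"
begin

abbreviation "v \<equiv> v_R C H \<rho> J"
abbreviation "v' \<equiv> v_R_inv C H \<rho> J'"

lemma J_typing [simp]:
  "J \<in> mor C" "dom C J = \<K>" "cod C J = X \<odot> X" "J' \<in> mor C" "dom C J' = \<K>" "cod C J' = X \<odot> X"
  using inverse by (simp_all add: convolution_inverse_def hom_iff)

lemma J_inverse: "convolution C HH J J' = n \<otimes> n" "convolution C HH J' J = n \<otimes> n"
  using inverse by (simp_all add: convolution_inverse_def)

lemma v_typing [simp]:
  "v \<in> mor C" "dom C v = \<K>" "cod C v = X" "v' \<in> mor C" "dom C v' = \<K>" "cod C v' = X"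
  by (simp_all add: v_R_def v_R_inv_def)

lemma J_conormal: "(e \<otimes> i) \<cdot> J = n" "(i \<otimes> e) \<cdot> J = n"
  using conormal by (simp_all add: conormal_def)

text \<open>A morphism of monoids that sends \<open>J\<close> to the unit does the same with the inverse of \<open>J\<close>.\<close>

lemma J'_conormal: "(e \<otimes> i) \<cdot> J' = n" "(i \<otimes> e) \<cdot> J' = n"
proof -
  have *: "f \<cdot> J' = n" if f: "monoid_hom HH H f" and fJ: "f \<cdot> J = n" for f
  proof -
    note [simp] = monoid_homD(1-4)[OF f]
    have "convolution C H n (f \<cdot> J') = f \<cdot> convolution C HH J J'"
      using f fJ by (simp add: hom_conv)
    also have "\<dots> = n"
      using monoid_homD(4)[OF f] by (simp add: J_inverse)
    finally show ?thesis by simp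
  qed
  show "(e \<otimes> i) \<cdot> J' = n" "(i \<otimes> e) \<cdot> J' = n"
    using *[OF counit_tens_hom(1)[of H]] *[OF counit_tens_hom(2)[of H]] J_conormal by simp_all
qed

text \<open>The element that conjugates \<open>(\<delta> \<otimes> H) \<delta>\<close> into the iterated coproduct of the deformation, and its
  inverse.\<close>

definition "twist_twice = convolution C HHH ((d \<otimes> i) \<cdot> J) (J \<otimes> n)"
definition "twist_twice_inv = convolution C HHH (J' \<otimes> n) ((d \<otimes> i) \<cdot> J')"

lemma twist_twice_typing [simp]:
  "twist_twice \<in> mor C" "dom C twist_twice = \<K>" "cod C twist_twice = X \<odot> (X \<odot> X)"
  "twist_twice_inv \<in> mor C" "dom C twist_twice_inv = \<K>" "cod C twist_twice_inv = X \<odot> (X \<odot> X)"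
  by (simp_all add: twist_twice_def twist_twice_inv_def)

lemma comult_tens_hom: "monoid_hom HH HHH (d \<otimes> i)"
  using tensor_monoid_hom[of H H HH H d i] comult_hom id_monoid_hom[of H] by (simp add: tensor_monoid_assoc)

lemma tens_comult_hom: "monoid_hom HH HHH (i \<otimes> d)"
  using tensor_monoid_hom[of H H H HH i d] comult_hom id_monoid_hom[of H] by simp

lemma twist_twice_eq: "twist_twice = convolution C HHH ((i \<otimes> d) \<cdot> J) (n \<otimes> J)"
  using twist by (simp add: twist_def twist_twice_def tensor_monoid_assoc)

lemma conv_tens_unit:
  assumes "f \<in> mor C" "g \<in> mor C" "cod C f = X \<odot> X" "cod C g = X \<odot> X"
    and "dom C f = \<K> \<or> dom C g = \<K>"
  shows "convolution C HHH (f \<otimes> n) (g \<otimes> n) = convolution C HH f g \<otimes> n"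
    "convolution C HHH (n \<otimes> f) (n \<otimes> g) = n \<otimes> convolution C HH f g"
  using assms conv_tens[of HH H f g n n] conv_tens[of H HH n n f g] by (simp_all add: tensor_monoid_assoc)

lemma comult_conv:
  assumes "f \<in> mor C" "g \<in> mor C" "cod C f = X \<odot> X" "cod C g = X \<odot> X"
  shows "convolution C HHH ((d \<otimes> i) \<cdot> f) ((d \<otimes> i) \<cdot> g) = (d \<otimes> i) \<cdot> convolution C HH f g"
    "convolution C HHH ((i \<otimes> d) \<cdot> f) ((i \<otimes> d) \<cdot> g) = (i \<otimes> d) \<cdot> convolution C HH f g"
  using assms by (simp_all add: hom_conv[OF comult_tens_hom] hom_conv[OF tens_comult_hom])

lemma conv_cancel_mid:
  assumes M: "is_monoid C M" and "f \<in> mor C" "g \<in> mor C" "h \<in> mor C" "k \<in> mor C"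
    "cod C f = obj M" "cod C g = obj M" "cod C h = obj M" "cod C k = obj M"
    and "convolution C M g h = \<eta> M"
  shows "convolution C M (convolution C M f g) (convolution C M h k) = convolution C M f k"
proof -
  have "convolution C M (convolution C M f g) (convolution C M h k) =
      convolution C M f (convolution C M (convolution C M g h) k)"
    using assms(1-9) by (simp add: conv_assoc)
  then show ?thesis using assms by simp
qed

text \<open>Both sides are convolution inverses of \<open>twist_twice\<close>, the right one because of the second
  expression \<open>twist_twice_eq\<close>.\<close>

lemma twist_twice_inv_eq: "twist_twice_inv = convolution C HHH (n \<otimes> J') ((i \<otimes> d) \<cdot> J')"
proof -
  let ?G = "convolution C HHH (n \<otimes> J') ((i \<otimes> d) \<cdot> J')"
  have 1: "(d \<otimes> i) \<cdot> (n \<otimes> n) = n \<otimes> (n \<otimes> n)" "(i \<otimes> d) \<cdot> (n \<otimes> n) = n \<otimes> (n \<otimes> n)"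
    by (simp_all add: interchange')
  have "convolution C HHH twist_twice_inv twist_twice = n \<otimes> (n \<otimes> n)"
    unfolding twist_twice_def twist_twice_inv_def 
    by (subst conv_cancel_mid) (simp_all add: comult_conv J_inverse 1 conv_tens_unit)
  moreover have "convolution C HHH twist_twice ?G = n \<otimes> (n \<otimes> n)"
    unfolding twist_twice_eq
    by (subst conv_cancel_mid) (simp_all add: comult_conv J_inverse 1 conv_tens_unit)
  ultimately show ?thesis
    using conv_assoc[of HHH twist_twice_inv twist_twice ?G] conv_unit_left[of HHH ?G] conv_unit_right[of HHH twist_twice_inv] by simp
qed

lemma contract_last_J': "contract_last n (n \<otimes> J') = n \<otimes> v'"
  by (simp add: contract_point sandwich_unit v_R_inv_def)

lemma contract_mid_J: "contract_mid n (n \<otimes> J) = n \<otimes> v"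
  by (simp add: contract_point sandwich_unit v_R_def)

lemma contract_unit: "contract_last n (n \<otimes> (n \<otimes> n)) = n \<otimes> n" "contract_mid n (n \<otimes> (n \<otimes> n)) = n \<otimes> n"
proof -
  have mn: "m \<cdot> (n \<otimes> n) = n"
    using conv_unit_left[of H n] by (simp add: convolution_def)
  show "contract_last n (n \<otimes> (n \<otimes> n)) = n \<otimes> n" "contract_mid n (n \<otimes> (n \<otimes> n)) = n \<otimes> n"
    by (simp_all add: contract_point sandwich_unit interchange' antipode_unit mn)
qed

text \<open>On elements this says \<open>J1 v' \<rho>(J2) = 1\<close>. Contracting \<open>J * J' = 1\<close> one factor at a time gives it,
  because \<open>J'\<close> contracts to \<open>v'\<close>.\<close>

lemma contract_last_J: "contract_last v' (n \<otimes> J) = n \<otimes> n"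
proof -
  have "contract_last n (convolution C HHH (n \<otimes> J) (n \<otimes> J')) = contract_last v' (n \<otimes> J)"
    using contract_last_conv[of n v' "n \<otimes> J" "n \<otimes> J'" n] contract_last_J' by (simp add: unit_cancel)
  then show ?thesis
    by (simp add: conv_tens_unit J_inverse contract_unit)
qed

text \<open>On elements \<open>\<rho>(J'1) v J'2 = 1\<close>, again by contracting \<open>J * J'\<close>.\<close>

lemma contract_mid_J': "contract_mid v (n \<otimes> J') = n \<otimes> n"
proof -
  have "contract_mid n (convolution C HHH (n \<otimes> J) (n \<otimes> J')) = contract_mid v (n \<otimes> J')"
    using contract_mid_conv[of n v "n \<otimes> J" "n \<otimes> J'" n] contract_mid_J by (simp add: unit_cancel)
  then show ?thesis
    by (simp add: conv_tens_unit J_inverse contract_unit)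
qed

lemma contract_last_twist_twice: "contract_last v' twist_twice = n \<otimes> n"
  using contract_last_conv[of v' n "(i \<otimes> d) \<cdot> J" "n \<otimes> J" n] contract_last_J unit_cancel(2)[of "n \<otimes> n" X]
  by (simp add: twist_twice_eq unit_cancel contract_tens_comult J_conormal)

lemma contract_last_twist_twice_inv: "contract_last n twist_twice_inv = n \<otimes> v'"
  using contract_last_conv[of n n "n \<otimes> J'" "(i \<otimes> d) \<cdot> J'" n] contract_last_J' unit_cancel(2)[of "n \<otimes> v'" X]
  by (simp add: twist_twice_inv_eq unit_cancel contract_tens_comult J'_conormal)

lemma contract_mid_twist_twice_inv: "contract_mid v twist_twice_inv = n \<otimes> n"
  using contract_mid_conv[of v n "n \<otimes> J'" "(i \<otimes> d) \<cdot> J'" n] contract_mid_J'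
  by (simp add: twist_twice_inv_eq unit_cancel contract_tens_comult J'_conormal)

lemma contract_mid_twist_twice: "contract_mid n twist_twice = n \<otimes> v"
  using contract_mid_conv[of n n "(i \<otimes> d) \<cdot> J" "n \<otimes> J" n] contract_mid_J
  by (simp add: twist_twice_eq unit_cancel contract_tens_comult J_conormal)

section \<open>The twist deformation\<close>

abbreviation "HJ \<equiv> twist_deformation C H J J'"

lemma twist_deformation_simps [simp]: "obj HJ = X" "\<eta> HJ = n" "\<mu> HJ = m" "\<epsilon> HJ = e"
  by (simp_all add: twist_deformation_def)

lemma twisted_comult_conv: "\<delta> HJ = convolution C HH (convolution C HH J' d) J"
proof -
  have "\<delta> HJ = \<mu> HH \<cdot> ((\<mu> HH \<otimes> (i \<otimes> i)) \<cdot> ((J' \<otimes> d) \<otimes> J))"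
    by (simp add: twist_deformation_def)
  also have "(\<mu> HH \<otimes> (i \<otimes> i)) \<cdot> ((J' \<otimes> d) \<otimes> J) = (\<mu> HH \<cdot> (J' \<otimes> d)) \<otimes> J"
    by (subst interchange') simp_all
  finally show ?thesis by (simp add: convolution_def)
qed

lemma twisted_comult_typing [simp]: "\<delta> HJ \<in> mor C" "dom C (\<delta> HJ) = X" "cod C (\<delta> HJ) = X \<odot> X"
  by (simp_all add: twisted_comult_conv)

text \<open>Conjugation by \<open>J\<close> on two factors, applied twice.\<close>

lemma twisted_comult_twice: "(\<delta> HJ \<otimes> i) \<cdot> \<delta> HJ = convolution C HHH twist_twice_inv (convolution C HHH comult_twice twist_twice)"
proof -
  have "\<delta> HJ \<otimes> i = convolution C HHH (convolution C HHH (J' \<otimes> n) (d \<otimes> i)) (J \<otimes> n)"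
    using conv_tens[of HH H J' d n i] conv_tens[of HH H "convolution C HH J' d" J i n]
    by (simp add: twisted_comult_conv tensor_monoid_assoc)
  then have "(\<delta> HJ \<otimes> i) \<cdot> \<delta> HJ =
      convolution C HHH (convolution C HHH (J' \<otimes> n) ((d \<otimes> i) \<cdot> \<delta> HJ)) (J \<otimes> n)"
    by (simp add: conv_comp_left conv_comp_right)
  also have "(d \<otimes> i) \<cdot> \<delta> HJ = convolution C HHH (convolution C HHH ((d \<otimes> i) \<cdot> J') comult_twice) ((d \<otimes> i) \<cdot> J)"
    unfolding twisted_comult_conv by (simp add: hom_conv[OF comult_tens_hom] comult_twice_def)
  finally show ?thesis
    by (simp add: twist_twice_def twist_twice_inv_def conv_assoc)
qed

text \<open>The three factors of the iterated coproduct are removed from right to left, since they are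
  nested with the last one innermost.\<close>

lemma contract_last_twisted: "contract_last v' ((\<delta> HJ \<otimes> i) \<cdot> \<delta> HJ) = i \<otimes> v'"
proof -
  have "contract_last v' (convolution C HHH comult_twice twist_twice) = i \<otimes> n"
    using contract_last_conv[of v' n comult_twice twist_twice n] contract_last_twist_twice unit_cancel(2)[of "i \<otimes> n" X]
    by (simp add: unit_cancel contract_last_comult_twice)
  then show ?thesis
    using contract_last_conv[of v' n twist_twice_inv "convolution C HHH comult_twice twist_twice" i] unit_cancel(1)[of "i \<otimes> v'" X]
    by (simp add: twisted_comult_twice contract_last_twist_twice_inv interchange' symm_point_left)
qed

text \<open>Here the first factor is innermost.\<close>

lemma contract_mid_twisted: "contract_mid v ((\<delta> HJ \<otimes> i) \<cdot> \<delta> HJ) = i \<otimes> v"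
proof -
  have 1: "contract_mid n (convolution C HHH comult_twice twist_twice) = i \<otimes> v"
    using contract_mid_conv[of n n comult_twice twist_twice i] contract_mid_twist_twice conv_unit_right[of H i]
    by (simp add: contract_mid_comult_twice fuse_right convolution_def)
  show ?thesis
    using contract_mid_conv[of v n twist_twice_inv "convolution C HHH comult_twice twist_twice" n] contract_mid_twist_twice_inv
    by (simp add: twisted_comult_twice unit_cancel 1)
qed

text \<open>By definition of \<open>F = twist_twice\<close>, \<open>F * (J' \<otimes> \<eta>) = (\<delta> \<otimes> H) J\<close>. Apply
  \<open>x \<otimes> y \<otimes> z \<mapsto> x \<rho>(y) z\<close>. The right-hand side becomes \<open>1\<close> by the antipode law and conormality. On the
  left, the factor \<open>J'\<close> is innermost in \<open>x \<rho>(y)\<close> and contracts to \<open>v'\<close>, which leaves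
  \<open>F1 v' \<rho>(F2) F3\<close>; this is \<open>v' v\<close> because \<open>F1 \<otimes> \<rho>(F2) F3 = 1 \<otimes> v\<close>.\<close>

lemma v_R_inverse: "convolution C H v' v = n"
proof -
  let ?O = "op_monoid H" and ?s = "sandwich H n" and ?s' = "sandwich H v'"
  let ?T = "tensor_monoid C H ?O" and ?Q = "i \<otimes> (\<rho> \<otimes> i)"
  have hom: "monoid_hom HH ?T (i \<otimes> \<rho>)"
    using antipode_hom id_monoid_hom[of H] by (simp add: tensor_monoid_hom)
  (* The nested contraction with the unit object as first monoid: only two letters are present. *)
  have "(\<one> \<K> \<otimes> ?s) \<cdot> convolution C (tensor_monoid C unit_monoid ?T) (i \<otimes> \<rho>) ((i \<otimes> \<rho>) \<cdot> J') = ?s' \<cdot> (i \<otimes> \<rho>)"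
    using sandwich_conv_op_right[of unit_monoid H n v' "i \<otimes> \<rho>" "(i \<otimes> \<rho>) \<cdot> J'" "\<one> \<K>"]
    by (simp add: sandwich_unit v_R_inv_def symm_unit_right)
  moreover have "(i \<otimes> \<rho>) \<cdot> convolution C HH (i \<otimes> i) J' = convolution C ?T (i \<otimes> \<rho>) ((i \<otimes> \<rho>) \<cdot> J')"
    by (simp add: hom_conv[OF hom])
  ultimately have 1: "?s \<cdot> ((i \<otimes> \<rho>) \<cdot> convolution C HH (i \<otimes> i) J') = ?s' \<cdot> (i \<otimes> \<rho>)"
    by (simp add: convolution_def unit_tensor_mult)
  have "convolution C HHH twist_twice (J' \<otimes> n) = convolution C HHH ((d \<otimes> i) \<cdot> J) (convolution C HHH (J \<otimes> n) (J' \<otimes> n))"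
    by (simp add: twist_twice_def conv_assoc)
  then have "convolution C HHH twist_twice (J' \<otimes> n) = (d \<otimes> i) \<cdot> J"
    using conv_unit_right[of HHH "(d \<otimes> i) \<cdot> J"] by (simp add: conv_tens_unit J_inverse)
  moreover have "convolution C HHH twist_twice (J' \<otimes> n) = convolution C HHH (i \<otimes> (i \<otimes> i)) (J' \<otimes> n) \<cdot> twist_twice"
    by (simp add: conv_comp_left)
  moreover have "convolution C HHH (i \<otimes> (i \<otimes> i)) (J' \<otimes> n) = convolution C HH (i \<otimes> i) J' \<otimes> i"
    using conv_tens[of HH H "i \<otimes> i" J' i n] by (simp add: tensor_monoid_assoc)
  ultimately have 2: "(convolution C HH (i \<otimes> i) J' \<otimes> i) \<cdot> twist_twice = (d \<otimes> i) \<cdot> J"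
    by simp
  have "((?s' \<cdot> (i \<otimes> \<rho>)) \<otimes> i) \<cdot> twist_twice = (((m \<cdot> (i \<otimes> \<rho>)) \<cdot> convolution C HH (i \<otimes> i) J') \<otimes> i) \<cdot> twist_twice"
    unfolding 1[symmetric] by (simp add: sandwich_unit)
  also have "((m \<cdot> (i \<otimes> \<rho>)) \<cdot> convolution C HH (i \<otimes> i) J') \<otimes> i =
      ((m \<cdot> (i \<otimes> \<rho>)) \<otimes> i) \<cdot> (convolution C HH (i \<otimes> i) J' \<otimes> i)"
    by (subst interchange') simp_all
  also have "\<dots> \<cdot> twist_twice = ((m \<cdot> (i \<otimes> \<rho>)) \<otimes> i) \<cdot> ((convolution C HH (i \<otimes> i) J' \<otimes> i) \<cdot> twist_twice)"
    by simp
  also have "\<dots> = (((m \<cdot> (i \<otimes> \<rho>)) \<otimes> i) \<cdot> (d \<otimes> i)) \<cdot> J"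
    unfolding 2 by simp
  also have "((m \<cdot> (i \<otimes> \<rho>)) \<otimes> i) \<cdot> (d \<otimes> i) = (n \<otimes> i) \<cdot> (e \<otimes> i)"
    using interchange'[of d "m \<cdot> (i \<otimes> \<rho>)" i i] interchange'[of e n i i] antipode_counit(1) by simp
  also have "\<dots> \<cdot> J = n \<otimes> n"
    using point_left[of i n n] by (simp add: J_conormal)
  finally have 3: "((?s' \<cdot> (i \<otimes> \<rho>)) \<otimes> i) \<cdot> twist_twice = n \<otimes> n" .
  have "m \<cdot> ((?s' \<cdot> (i \<otimes> \<rho>)) \<otimes> i) = ?s' \<cdot> ((i \<otimes> m) \<cdot> ?Q)"
  proof -
    have "m \<cdot> ((?s' \<cdot> (i \<otimes> \<rho>)) \<otimes> i) = convolution C H (convolution C H i (convolution C H v' \<rho>)) i"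
      by (simp add: sandwich_comp convolution_def[of C H _ i])
    also have "\<dots> = ?s' \<cdot> (i \<otimes> convolution C H \<rho> i)"
      by (simp add: conv_assoc sandwich_comp)
    finally show ?thesis
      by (simp add: convolution_def interchange')
  qed
  then have "m \<cdot> (((?s' \<cdot> (i \<otimes> \<rho>)) \<otimes> i) \<cdot> twist_twice) = ?s' \<cdot> contract_mid n twist_twice"
    using comp_assoc'[of twist_twice "(?s' \<cdot> (i \<otimes> \<rho>)) \<otimes> i" m] by (simp add: contract_mid_def sandwich_unit)
  then have "convolution C H n n = convolution C H n (convolution C H v' v)"
    unfolding 3 contract_mid_twist_twice by (simp add: sandwich_comp convolution_def[of C H n n])
  then show ?thesis by simp
qed

lemma twisted_antipode_conv:
  "twisted_antipode C H \<rho> J J' = convolution C H (convolution C H v' \<rho>) v"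
  by (simp add: twisted_antipode_def convolution_def)

text \<open>The outer factors \<open>v\<close> and \<open>v'\<close> of the deformed antipode are split off: one of them
  enters the contraction as its middle element and the other multiplies the result, which is then
  \<open>h \<otimes> v' v\<close> in both cases.\<close>

lemma twisted_right_antipode: "right_antipode C HJ (twisted_antipode C H \<rho> J J')"
proof -
  let ?r = "twisted_antipode C H \<rho> J J'" and ?d = "\<delta> HJ"
  have r: "?r \<in> mor C" "dom C ?r = X" "cod C ?r = X"
    by (simp_all add: twisted_antipode_conv)
  note [simp] = r
  have "m \<cdot> (i \<otimes> ?r) = convolution C H i v \<cdot> (sandwich H v' \<cdot> (i \<otimes> \<rho>))"
  proof -
    have "m \<cdot> (i \<otimes> ?r) = convolution C H (sandwich H v' \<cdot> (i \<otimes> \<rho>)) v"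
      by (simp add: sandwich_comp conv_assoc twisted_antipode_conv flip: convolution_def[of C H])
    then show ?thesis
      by (simp add: conv_comp_left)
  qed
  then have "i \<otimes> (m \<cdot> (i \<otimes> ?r)) =
      (i \<otimes> convolution C H i v) \<cdot> ((i \<otimes> sandwich H v') \<cdot> (i \<otimes> (i \<otimes> \<rho>)))"
    by (simp add: interchange')
  moreover have "(i \<otimes> m) \<cdot> (?d \<otimes> ?r) = (i \<otimes> (m \<cdot> (i \<otimes> ?r))) \<cdot> (?d \<otimes> i)"
    using interchange'[of ?d "i \<otimes> i" i ?r] interchange'[of i i "i \<otimes> ?r" m] 
      comp_assoc'[of "?d \<otimes> i" "i \<otimes> (i \<otimes> ?r)" "i \<otimes> m"] by simp
  ultimately have "((i \<otimes> m) \<cdot> (?d \<otimes> ?r)) \<cdot> ?d =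
      (i \<otimes> convolution C H i v) \<cdot> contract_last v' ((?d \<otimes> i) \<cdot> ?d)"
    by (simp add: contract_last_def)
  also have "\<dots> = i \<otimes> n"
    unfolding contract_last_twisted by (simp add: interchange' conv_comp_left v_R_inverse)
  finally have A: "((i \<otimes> m) \<cdot> (?d \<otimes> ?r)) \<cdot> ?d = i \<otimes> n" .
  have "m \<cdot> (?r \<otimes> i) = convolution C H v' i \<cdot> (sandwich H v \<cdot> (\<rho> \<otimes> i))"
  proof -
    have "m \<cdot> (?r \<otimes> i) = convolution C H v' (sandwich H v \<cdot> (\<rho> \<otimes> i))"
      by (simp add: sandwich_comp conv_assoc twisted_antipode_conv flip: convolution_def[of C H])
    then show ?thesis
      by (simp add: conv_comp_right)
  qed
  then have "i \<otimes> (m \<cdot> (?r \<otimes> i)) =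
      (i \<otimes> convolution C H v' i) \<cdot> ((i \<otimes> sandwich H v) \<cdot> (i \<otimes> (\<rho> \<otimes> i)))"
    by (simp add: interchange')
  moreover have "(i \<otimes> m) \<cdot> (((i \<otimes> ?r) \<cdot> ?d) \<otimes> i) = (i \<otimes> (m \<cdot> (?r \<otimes> i))) \<cdot> (?d \<otimes> i)"
    using interchange'[of ?d "i \<otimes> ?r" i i] interchange'[of i i "?r \<otimes> i" m] 
      comp_assoc'[of "?d \<otimes> i" "i \<otimes> (?r \<otimes> i)" "i \<otimes> m"] by simp
  ultimately have "((i \<otimes> m) \<cdot> (((i \<otimes> ?r) \<cdot> ?d) \<otimes> i)) \<cdot> ?d =
      (i \<otimes> convolution C H v' i) \<cdot> contract_mid v ((?d \<otimes> i) \<cdot> ?d)"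
    by (simp add: contract_mid_def)
  also have "\<dots> = i \<otimes> n"
    unfolding contract_mid_twisted by (simp add: interchange' conv_comp_right v_R_inverse)
  finally have B: "((i \<otimes> m) \<cdot> (((i \<otimes> ?r) \<cdot> ?d) \<otimes> i)) \<cdot> ?d = i \<otimes> n" .
  show ?thesis
    unfolding right_antipode_def twist_deformation_simps using A B by (simp add: hom_iff del: comp_assoc')
qed

text \<open>Conjugation by an invertible element preserves multiplicativity, and conormality preserves the
  counit laws.\<close>

lemma twist_deformation_bimonoid: "noncoassociative_bimonoid C HJ"
proof -
  have T: "tensor_monoid C HJ HJ = HH"
    by (simp add: tensor_monoid_def)
  have unit: "f \<cdot> \<delta> HJ = f \<cdot> d" 
    if f: "monoid_hom HH H f" "f \<cdot> J = n" "f \<cdot> J' = n" for f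
    using f(2,3) monoid_homD(1-4)[OF f(1)] by (simp add: twisted_comult_conv hom_conv[OF f(1)])
  have "(e \<otimes> i) \<cdot> \<delta> HJ = i" "(i \<otimes> e) \<cdot> \<delta> HJ = i"
    using unit[OF counit_tens_hom(1)[of H]] unit[OF counit_tens_hom(2)[of H]] by (simp_all add: J_conormal J'_conormal)
  moreover have "\<delta> HJ \<cdot> n = n \<otimes> n"
    using conv_unit_right[of HH J'] by (simp add: twisted_comult_conv conv_comp_left conv_comp_right J_inverse)
  moreover have "\<delta> HJ \<cdot> m = \<mu> HH \<cdot> (\<delta> HJ \<otimes> \<delta> HJ)"
  proof -
    have "\<delta> HJ \<cdot> m = convolution C HH (convolution C HH J' (d \<cdot> m)) J"
      by (simp add: twisted_comult_conv conv_comp_left conv_comp_right)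
    also have "d \<cdot> m = convolution C HH d d"
      using monoid_homD(5)[OF comult_hom] by (simp add: convolution_def)
    also have "convolution C HH (convolution C HH J' (convolution C HH d d)) J = 
        convolution C HH (convolution C HH (convolution C HH J' d) J) (convolution C HH J' (convolution C HH d J))"
      using conv_cancel_mid[of HH "convolution C HH J' d" J J' "convolution C HH d J"]
      by (simp add: J_inverse conv_assoc)
    also have "\<dots> = \<mu> HH \<cdot> (\<delta> HJ \<otimes> \<delta> HJ)"
      by (simp add: twisted_comult_conv conv_assoc convolution_def[of C HH "convolution C HH J' (convolution C HH d J)"])
    finally show ?thesis .
  qed
  moreover have "is_monoid C HJ"
    using H_monoid unfolding is_monoid_def twist_deformation_simps .
  ultimately show ?thesis
    using bimonoid by (simp add: noncoassociative_bimonoid_def counital_comagma_def T hom_iff)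
qed

end

theorem theorem3p1p14:
  fixes C :: "('o, 'm) smcat"
    and H :: "('o, 'm) bimonoid_data"
    and \<rho> J J' :: 'm
  assumes "strict_symmetric_monoidal_category C"
    and "right_Hopf_coquasigroup C H"
    and "right_antipode C H \<rho>"
    and "twist C H J"
    and "conormal C H J"
    and "convolution_inverse C (tensor_monoid C H H) J J'"
  shows "right_Hopf_coquasigroup C (twist_deformation C H J J')
    \<and> right_antipode C (twist_deformation C H J J') (twisted_antipode C H \<rho> J J')"
proof -
  interpret strict_symmetric_monoidal_category C
    by fact
  interpret twisted_right_Hopf_coquasigroup C H \<rho> J J'
    using assms by unfold_locales (simp_all add: right_Hopf_coquasigroup_def)
  show ?thesis
    using twisted_right_antipode twist_deformation_bimonoid
    by (auto simp: right_Hopf_coquasigroup_def)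
qed

end
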